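(* Let $\mathfrak X$ be a 3-Hilbert space and $a,b\in\mathfrak X$. If there is a natural unitary equivalence $$\mathfrak X(-\to a)\cong^\dagger\mathfrak X(-\to b)$$ that is pointwise isometric (that is, its components are isometric equivalences of 2-Hilbert spaces), then the representing equivalence $a\simeq b$ is an isometric equivalence in $\mathfrak X$.
   Context: **2-Hilbert spaces.** A 2-Hilbert space is a finitely semisimple $C^*$-category $\mathcal C$ with faithful positive linear functionals $\mathrm{Tr}^{\mathcal C}_c:\mathrm{End}(c)\to\mathbb C$ such that $\mathrm{Tr}_a(gf)=\mathrm{Tr}_b(fg)$ for $f:a\to b$, $g:b\to a$. An isometric equivalence of 2-Hilbert spaces is a trace-preserving $\dagger$-equivalence. $2\mathrm{Hilb}$ denotes the 2-category of 2-Hilbert spaces, linear $\dagger$-functors and natural transformations. **(Pre-)3-Hilbert spaces.** A unitary 2-category is a $C^*$-2-category $\mathfrak X$ such that for all $a_1,\dots,a_n\in\mathfrak X$ the linking category $\mathcal L=\bigoplus_{i,j}\mathfrak X(a_j\to a_i)$ (matrix multiplication and composition) is a unitary multitensor category; it is finite if all $\mathcal L$ are multifusion and $\dim \mathrm{End}_{\mathcal Z(\mathcal L)}(1_{\mathcal L})$ is globally bounded ($\mathcal Z$ is the Drinfeld center). A 1-morphism $X:a\to b$ is written ${}_aX_b$, and ${}_aX\otimes_bY_c:a\to c$ is "first $X$, then $Y$". A unitary adjoint functor (UAF) $\vee$ is a choice for each ${}_aX_b$ of an adjoint ${}_bX^\vee_a$ with $\mathrm{ev}_X:X^\vee\otimes_aX\Rightarrow1_b$,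 $\mathrm{coev}_X:1_a\Rightarrow X\otimes_bX^\vee$ satisfying the zig-zag equations, such that the canonical maps $1_a^\vee\to1_a$ and $X^\vee\otimes Y^\vee\Rightarrow(Y\otimes X)^\vee$ are unitary and $(f^\vee)^\dagger=(f^\dagger)^\vee$. A spherical weight $\Psi$ is a family of faithful positive functionals $\Psi_a:\mathrm{End}(1_a)\to\mathbb C$ with $\Psi_a(\mathrm{coev}_X^\dagger(f\otimes1)\mathrm{coev}_X)=\Psi_b(\mathrm{ev}_X(1\otimes f)\mathrm{ev}_X^\dagger)=:\mathrm{Tr}_X(f)$ for all $f\in\mathrm{End}({}_aX_b)$; with these traces each $\mathfrak X(a\to b)$ is a 2-Hilbert space. A pre-3-Hilbert space is a finite unitary 2-category with a UAF and a spherical weight. A 1-morphism ${}_aX_b$ is an isometry if $\mathrm{coev}_X$ is unitary and $\mathrm{ev}_X$ is an isometry, and an isometric equivalence if both $\mathrm{ev}_X$ and $\mathrm{coev}_X$ are unitary. A Hilbert direct sum of $a,b$ is an object $a\boxplus b$ with isometries $I:a\to a\boxplus b$, $J:b\to a\boxplus b$ such that $\mathrm{ev}_I\mathrm{ev}_I^\dagger+\mathrm{ev}_J\mathrm{ev}_J^\dagger=\mathrm{id}_{1_{a\boxplus b}}$. An $H^*$-monad on $a$ is an associative unital algebra $({}_aA_a,\mu,\iota)$ in $\mathfrak X(a\to a)$ such that $\mu^\dagger$ is an $A$–$A$-bimodule map, $\mu\mu^\dagger$ is invertible, and $\Psi_a(\iota^\dagger\mu(1\otimes f)\mu^\dagger\iota)=\Psi_a(\iota^\dagger\mu(f\otimes1)\mu^\dagger\iota)$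 for all $f\in\mathrm{End}(A)$. It splits if there are ${}_aX_b$ with $\mathrm{ev}_X\mathrm{ev}_X^\dagger$ invertible and a unitary algebra isomorphism $A\cong X\otimes_bX^\vee$. A 3-Hilbert space is a pre-3-Hilbert space admitting all (finite) Hilbert direct sums and in which all $H^*$-monads split. **Representing equivalence.** The functors $\mathfrak X(-\to a),\mathfrak X(-\to b):\mathfrak X^{1\mathrm{op}}\to2\mathrm{Hilb}$ ($\mathfrak X^{1\mathrm{op}}$ reverses 1-morphisms) are representable $\dagger$-2-functors. A natural unitary equivalence is a 2-natural transformation with unitary naturators that is an equivalence. By the Yoneda lemma such an equivalence is given, up to isomorphism, by $-\otimes_aX_b$ for an equivalence ${}_aX_b$ in $\mathfrak X$ (the image of $1_a$); ${}_aX_b$ is the representing equivalence. *)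

theory Defs
  imports "HOL-Analysis.Analysis" "HOL-Library.Function_Algebras"
begin

section \<open>Dagger categories, C*-categories and 2-Hilbert spaces\<close>

text \<open>
  The hom-spaces of a complex linear category are presented as subspaces of one ambient complex
  vector space (an \<^class>\<open>ab_group_add\<close> type with a complex scalar multiplication).  This
  is no restriction: any family of vector spaces embeds in its direct sum.  Distinct hom-spaces may
  overlap (they always share 0), so operations whose value depends on source and target take these
  as arguments.  In \<open>g \<cdot> f\<close> the morphism \<open>f\<close> comes first.
\<close>

record ('x, 'f) dcat =
  objs :: "'x set"
  hom :: "'x \<Rightarrow> 'x \<Rightarrow> 'f set"
  scal :: "complex \<Rightarrow> 'f \<Rightarrow> 'f"
  idn :: "'x \<Rightarrow> 'f"
  cmp :: "'f \<Rightarrow> 'f \<Rightarrow> 'f" (infixr "\<cdot>\<index>" 75)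
  dag :: "'f \<Rightarrow> 'f"

locale dagger_category =
  fixes C :: "('x, 'f::ab_group_add, 'z) dcat_scheme" (structure)
  assumes vs: "vector_space (scal C)"
    and hom_subspace: "\<lbrakk>X \<in> objs C; Y \<in> objs C\<rbrakk> \<Longrightarrow> module.subspace (scal C) (hom C X Y)"
    and idn_hom: "X \<in> objs C \<Longrightarrow> idn C X \<in> hom C X X"
    and cmp_hom: "\<lbrakk>X \<in> objs C; Y \<in> objs C; Z \<in> objs C; f \<in> hom C X Y; g \<in> hom C Y Z\<rbrakk>
          \<Longrightarrow> g \<cdot> f \<in> hom C X Z"
    and cmp_idn: "\<lbrakk>X \<in> objs C; Y \<in> objs C; f \<in> hom C X Y\<rbrakk> \<Longrightarrow> f \<cdot> idn C X = f"
    and idn_cmp: "\<lbrakk>X \<in> objs C; Y \<in> objs C; f \<in> hom C X Y\<rbrakk> \<Longrightarrow> idn C Y \<cdot> f = f"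
    and cmp_assoc: "\<lbrakk>W \<in> objs C; X \<in> objs C; Y \<in> objs C; Z \<in> objs C;
          f \<in> hom C W X; g \<in> hom C X Y; h \<in> hom C Y Z\<rbrakk> \<Longrightarrow> (h \<cdot> g) \<cdot> f = h \<cdot> (g \<cdot> f)"
    and cmp_add_left: "\<lbrakk>X \<in> objs C; Y \<in> objs C; Z \<in> objs C;
          f \<in> hom C X Y; g \<in> hom C Y Z; g' \<in> hom C Y Z\<rbrakk> \<Longrightarrow> (g + g') \<cdot> f = g \<cdot> f + g' \<cdot> f"
    and cmp_add_right: "\<lbrakk>X \<in> objs C; Y \<in> objs C; Z \<in> objs C;
          f \<in> hom C X Y; f' \<in> hom C X Y; g \<in> hom C Y Z\<rbrakk> \<Longrightarrow> g \<cdot> (f + f') = g \<cdot> f + g \<cdot> f'"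
    and cmp_scal_left: "\<lbrakk>X \<in> objs C; Y \<in> objs C; Z \<in> objs C; f \<in> hom C X Y; g \<in> hom C Y Z\<rbrakk>
          \<Longrightarrow> scal C t g \<cdot> f = scal C t (g \<cdot> f)"
    and cmp_scal_right: "\<lbrakk>X \<in> objs C; Y \<in> objs C; Z \<in> objs C; f \<in> hom C X Y; g \<in> hom C Y Z\<rbrakk>
          \<Longrightarrow> g \<cdot> scal C t f = scal C t (g \<cdot> f)"
    and dag_hom: "\<lbrakk>X \<in> objs C; Y \<in> objs C; f \<in> hom C X Y\<rbrakk> \<Longrightarrow> dag C f \<in> hom C Y X"
    and dag_dag: "\<lbrakk>X \<in> objs C; Y \<in> objs C; f \<in> hom C X Y\<rbrakk> \<Longrightarrow> dag C (dag C f) = f"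
    and dag_cmp: "\<lbrakk>X \<in> objs C; Y \<in> objs C; Z \<in> objs C; f \<in> hom C X Y; g \<in> hom C Y Z\<rbrakk>
          \<Longrightarrow> dag C (g \<cdot> f) = dag C f \<cdot> dag C g"
    and dag_add: "\<lbrakk>X \<in> objs C; Y \<in> objs C; f \<in> hom C X Y; f' \<in> hom C X Y\<rbrakk>
          \<Longrightarrow> dag C (f + f') = dag C f + dag C f'"
    and dag_scal: "\<lbrakk>X \<in> objs C; Y \<in> objs C; f \<in> hom C X Y\<rbrakk>
          \<Longrightarrow> dag C (scal C t f) = scal C (cnj t) (dag C f)"

text \<open>
  A C*-norm on a dagger category is unique if it exists, so being a C*-category is a property.
\<close>

definition cstar_norm :: "('x, 'f::ab_group_add, 'z) dcat_scheme \<Rightarrow> ('x \<Rightarrow> 'x \<Rightarrow> 'f \<Rightarrow> real) \<Rightarrow> bool" where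
  "cstar_norm C nrm \<longleftrightarrow>
     (\<forall>X\<in>objs C. \<forall>Y\<in>objs C.
        (\<forall>f\<in>hom C X Y. 0 \<le> nrm X Y f \<and> (nrm X Y f = 0 \<longleftrightarrow> f = 0)) \<and>
        (\<forall>f\<in>hom C X Y. \<forall>g\<in>hom C X Y. nrm X Y (f + g) \<le> nrm X Y f + nrm X Y g) \<and>
        (\<forall>f\<in>hom C X Y. \<forall>t. nrm X Y (scal C t f) = cmod t * nrm X Y f) \<and>
        (\<forall>s. (\<forall>n. s n \<in> hom C X Y) \<and>
             (\<forall>e>0. \<exists>N::nat. \<forall>m\<ge>N. \<forall>n\<ge>N. nrm X Y (s m - s n) < e) \<longrightarrow>
             (\<exists>l\<in>hom C X Y. (\<lambda>n. nrm X Y (s n - l)) \<longlonglongrightarrow> 0)) \<and>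
        (\<forall>f\<in>hom C X Y. nrm X X (dag C f \<cdot>\<^bsub>C\<^esub> f) = (nrm X Y f)\<^sup>2) \<and>
        (\<forall>Z\<in>objs C. \<forall>f\<in>hom C X Y. \<forall>g\<in>hom C Y Z.
           nrm X Z (g \<cdot>\<^bsub>C\<^esub> f) \<le> nrm Y Z g * nrm X Y f))"

locale cstar_category = dagger_category +
  assumes ex_norm: "\<exists>nrm. cstar_norm C nrm"
    and dag_cmp_positive: "\<lbrakk>X \<in> objs C; Y \<in> objs C; f \<in> hom C X Y\<rbrakk>
          \<Longrightarrow> \<exists>h\<in>hom C X X. dag C f \<cdot> f = dag C h \<cdot> h"

context
  fixes C :: "('x, 'f::ab_group_add, 'z) dcat_scheme" (structure)
begin

definition isometric :: "'x \<Rightarrow> 'x \<Rightarrow> 'f \<Rightarrow> bool" where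
  "isometric X Y u \<longleftrightarrow> u \<in> hom C X Y \<and> dag C u \<cdot> u = idn C X"

definition unitary :: "'x \<Rightarrow> 'x \<Rightarrow> 'f \<Rightarrow> bool" where
  "unitary X Y u \<longleftrightarrow> u \<in> hom C X Y \<and> dag C u \<cdot> u = idn C X \<and> u \<cdot> dag C u = idn C Y"

definition invertible :: "'x \<Rightarrow> 'x \<Rightarrow> 'f \<Rightarrow> bool" where
  "invertible X Y u \<longleftrightarrow> u \<in> hom C X Y \<and> (\<exists>v\<in>hom C Y X. v \<cdot> u = idn C X \<and> u \<cdot> v = idn C Y)"

definition isomorphic :: "'x \<Rightarrow> 'x \<Rightarrow> bool" where
  "isomorphic X Y \<longleftrightarrow> (\<exists>u. invertible X Y u)"

definition simple :: "'x \<Rightarrow> bool" where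
  "simple S \<longleftrightarrow> S \<in> objs C \<and> idn C S \<noteq> 0 \<and> hom C S S = range (\<lambda>t. scal C t (idn C S))"

text \<open>The case \<open>n = 0\<close> says that \<open>S\<close> is a zero object.\<close>

definition orth_sum :: "nat \<Rightarrow> (nat \<Rightarrow> 'x) \<Rightarrow> 'x \<Rightarrow> (nat \<Rightarrow> 'f) \<Rightarrow> bool" where
  "orth_sum n Xs S \<iota> \<longleftrightarrow> S \<in> objs C \<and> (\<forall>k<n. \<iota> k \<in> hom C (Xs k) S) \<and>
     (\<forall>k<n. \<forall>l<n. dag C (\<iota> k) \<cdot> \<iota> l = (if k = l then idn C (Xs k) else 0)) \<and>
     (\<Sum>k<n. \<iota> k \<cdot> dag C (\<iota> k)) = idn C S"

definition semisimple :: bool where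
  "semisimple \<longleftrightarrow> cstar_category C \<and>
     (\<forall>n Xs. (\<forall>k<n. Xs k \<in> objs C) \<longrightarrow> (\<exists>S \<iota>. orth_sum n Xs S \<iota>)) \<and>
     (\<forall>X\<in>objs C. \<forall>p\<in>hom C X X. p \<cdot> p = p \<and> dag C p = p \<longrightarrow>
        (\<exists>Y\<in>objs C. \<exists>v. isometric Y X v \<and> v \<cdot> dag C v = p)) \<and>
     (\<forall>X\<in>objs C. \<exists>n Xs \<iota>. (\<forall>k<n. simple (Xs k)) \<and> orth_sum n Xs X \<iota>)"

definition finitely_semisimple :: bool where
  "finitely_semisimple \<longleftrightarrow> semisimple \<and>
     (\<exists>T. finite T \<and> T \<subseteq> objs C \<and> (\<forall>S. simple S \<longrightarrow> (\<exists>R\<in>T. isomorphic S R)))"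

text \<open>Positive elements of the C*-algebra \<open>End(X)\<close> are those of the form \<open>f\<^sup>\<dagger> f\<close>.\<close>

definition faithful_positive_functional :: "'x \<Rightarrow> ('f \<Rightarrow> complex) \<Rightarrow> bool" where
  "faithful_positive_functional X \<phi> \<longleftrightarrow>
     (\<forall>f\<in>hom C X X. \<forall>g\<in>hom C X X. \<phi> (f + g) = \<phi> f + \<phi> g) \<and>
     (\<forall>f\<in>hom C X X. \<forall>t. \<phi> (scal C t f) = t * \<phi> f) \<and>
     (\<forall>f\<in>hom C X X. \<phi> (dag C f \<cdot> f) \<in> \<real>\<^sub>\<ge>\<^sub>0) \<and>
     (\<forall>f\<in>hom C X X. \<phi> (dag C f \<cdot> f) = 0 \<longrightarrow> f = 0)"

definition two_hilbert_space :: "('x \<Rightarrow> 'f \<Rightarrow> complex) \<Rightarrow> bool" where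
  "two_hilbert_space Tr \<longleftrightarrow> finitely_semisimple \<and>
     (\<forall>X\<in>objs C. faithful_positive_functional X (Tr X)) \<and>
     (\<forall>X\<in>objs C. \<forall>Y\<in>objs C. \<forall>f\<in>hom C X Y. \<forall>g\<in>hom C Y X. Tr X (g \<cdot> f) = Tr Y (f \<cdot> g))"

end

text \<open>\<open>F1 X Y\<close> is the action on \<open>hom X Y\<close>.\<close>

definition linear_dagger_functor ::
  "('x, 'f::ab_group_add, 'z) dcat_scheme \<Rightarrow> ('y, 'g::ab_group_add, 'w) dcat_scheme \<Rightarrow>
     ('x \<Rightarrow> 'y) \<Rightarrow> ('x \<Rightarrow> 'x \<Rightarrow> 'f \<Rightarrow> 'g) \<Rightarrow> bool" where
  "linear_dagger_functor C D F0 F1 \<longleftrightarrow>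
     (\<forall>X\<in>objs C. F0 X \<in> objs D \<and> F1 X X (idn C X) = idn D (F0 X)) \<and>
     (\<forall>X\<in>objs C. \<forall>Y\<in>objs C. \<forall>f\<in>hom C X Y.
        F1 X Y f \<in> hom D (F0 X) (F0 Y) \<and>
        F1 Y X (dag C f) = dag D (F1 X Y f) \<and>
        (\<forall>t. F1 X Y (scal C t f) = scal D t (F1 X Y f)) \<and>
        (\<forall>f'\<in>hom C X Y. F1 X Y (f + f') = F1 X Y f + F1 X Y f') \<and>
        (\<forall>Z\<in>objs C. \<forall>g\<in>hom C Y Z. F1 X Z (g \<cdot>\<^bsub>C\<^esub> f) = F1 Y Z g \<cdot>\<^bsub>D\<^esub> F1 X Y f))"

definition unitary_natural_iso ::
  "('x, 'f::ab_group_add, 'z) dcat_scheme \<Rightarrow> ('y, 'g::ab_group_add, 'w) dcat_scheme \<Rightarrow>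
     ('x \<Rightarrow> 'y) \<Rightarrow> ('x \<Rightarrow> 'x \<Rightarrow> 'f \<Rightarrow> 'g) \<Rightarrow> ('x \<Rightarrow> 'y) \<Rightarrow> ('x \<Rightarrow> 'x \<Rightarrow> 'f \<Rightarrow> 'g) \<Rightarrow>
     ('x \<Rightarrow> 'g) \<Rightarrow> bool" where
  "unitary_natural_iso C D F0 F1 G0 G1 \<tau> \<longleftrightarrow>
     (\<forall>X\<in>objs C. unitary D (F0 X) (G0 X) (\<tau> X)) \<and>
     (\<forall>X\<in>objs C. \<forall>Y\<in>objs C. \<forall>f\<in>hom C X Y. \<tau> Y \<cdot>\<^bsub>D\<^esub> F1 X Y f = G1 X Y f \<cdot>\<^bsub>D\<^esub> \<tau> X)"

definition dagger_equivalence ::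
  "('x, 'f::ab_group_add, 'z) dcat_scheme \<Rightarrow> ('y, 'g::ab_group_add, 'w) dcat_scheme \<Rightarrow>
     ('x \<Rightarrow> 'y) \<Rightarrow> ('x \<Rightarrow> 'x \<Rightarrow> 'f \<Rightarrow> 'g) \<Rightarrow> bool" where
  "dagger_equivalence C D F0 F1 \<longleftrightarrow> linear_dagger_functor C D F0 F1 \<and>
     (\<exists>G0 G1 \<sigma> \<tau>. linear_dagger_functor D C G0 G1 \<and>
        unitary_natural_iso C C (\<lambda>X. X) (\<lambda>X Y f. f)
          (\<lambda>X. G0 (F0 X)) (\<lambda>X Y f. G1 (F0 X) (F0 Y) (F1 X Y f)) \<sigma> \<and>
        unitary_natural_iso D D (\<lambda>X. F0 (G0 X)) (\<lambda>X Y f. F1 (G0 X) (G0 Y) (G1 X Y f))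
          (\<lambda>X. X) (\<lambda>X Y f. f) \<tau>)"

definition isometric_equivalence_2Hilb ::
  "('x, 'f::ab_group_add, 'z) dcat_scheme \<Rightarrow> ('x \<Rightarrow> 'f \<Rightarrow> complex) \<Rightarrow>
   ('y, 'g::ab_group_add, 'w) dcat_scheme \<Rightarrow> ('y \<Rightarrow> 'g \<Rightarrow> complex) \<Rightarrow>
     ('x \<Rightarrow> 'y) \<Rightarrow> ('x \<Rightarrow> 'x \<Rightarrow> 'f \<Rightarrow> 'g) \<Rightarrow> bool" where
  "isometric_equivalence_2Hilb C TrC D TrD F0 F1 \<longleftrightarrow>
     two_hilbert_space C TrC \<and> two_hilbert_space D TrD \<and> dagger_equivalence C D F0 F1 \<and>
     (\<forall>X\<in>objs C. \<forall>f\<in>hom C X X. TrD (F0 X) (F1 X X f) = TrC X f)"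


section \<open>C*-2-categories\<close>

text \<open>
  The \<^type>\<open>dcat\<close> part of a 2-category consists of its 1-morphisms and 2-morphisms;
  its 0-cells are \<open>ob\<close>.  \<open>X \<otimes> Y\<close> is ``first \<open>X\<close>, then \<open>Y\<close>'', and
  \<open>hten X X' Y Y' f g\<close> is the horizontal composite \<open>f \<otimes> g\<close> of
  \<open>f : X \<Rightarrow> X'\<close> and \<open>g : Y \<Rightarrow> Y'\<close>.
  The associator is \<open>assoc X Y Z : (X \<otimes> Y) \<otimes> Z \<Rightarrow> X \<otimes> (Y \<otimes> Z)\<close>.
\<close>

record ('o, 'm, 'c) bicat = "('m, 'c) dcat" +
  ob :: "'o set"
  src :: "'m \<Rightarrow> 'o"
  tgt :: "'m \<Rightarrow> 'o"
  unit1 :: "'o \<Rightarrow> 'm"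
  ten :: "'m \<Rightarrow> 'm \<Rightarrow> 'm" (infixl "\<otimes>\<index>" 80)
  hten :: "'m \<Rightarrow> 'm \<Rightarrow> 'm \<Rightarrow> 'm \<Rightarrow> 'c \<Rightarrow> 'c \<Rightarrow> 'c"
  assoc :: "'m \<Rightarrow> 'm \<Rightarrow> 'm \<Rightarrow> 'c"
  lunit :: "'m \<Rightarrow> 'c"
  runit :: "'m \<Rightarrow> 'c"

definition mor1 :: "('o, 'm, 'c, 'z) bicat_scheme \<Rightarrow> 'o \<Rightarrow> 'o \<Rightarrow> 'm set" where
  "mor1 B a b = {X \<in> objs B. src B X = a \<and> tgt B X = b}"

definition homcat :: "('o, 'm, 'c, 'z) bicat_scheme \<Rightarrow> 'o \<Rightarrow> 'o \<Rightarrow> ('m, 'c) dcat" where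
  "homcat B a b = (dcat.truncate B)\<lparr>objs := mor1 B a b\<rparr>"

text \<open>\<open>lwh X Y Y' g\<close> is \<open>1\<^sub>X \<otimes> g\<close> for \<open>g : Y \<Rightarrow> Y'\<close>;
  \<open>rwh X X' Y f\<close> is \<open>f \<otimes> 1\<^sub>Y\<close> for \<open>f : X \<Rightarrow> X'\<close>.\<close>

definition lwh :: "('o, 'm, 'c, 'z) bicat_scheme \<Rightarrow> 'm \<Rightarrow> 'm \<Rightarrow> 'm \<Rightarrow> 'c \<Rightarrow> 'c" where
  "lwh B X Y Y' g = hten B X X Y Y' (idn B X) g"

definition rwh :: "('o, 'm, 'c, 'z) bicat_scheme \<Rightarrow> 'm \<Rightarrow> 'm \<Rightarrow> 'm \<Rightarrow> 'c \<Rightarrow> 'c" where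
  "rwh B X X' Y f = hten B X X' Y Y f (idn B Y)"

locale cstar_2category =
  fixes B :: "('o, 'm, 'c::ab_group_add, 'z) bicat_scheme" (structure)
  assumes src_ob: "X \<in> objs B \<Longrightarrow> src B X \<in> ob B"
    and tgt_ob: "X \<in> objs B \<Longrightarrow> tgt B X \<in> ob B"
    and homcat_cstar: "\<lbrakk>a \<in> ob B; b \<in> ob B\<rbrakk> \<Longrightarrow> cstar_category (homcat B a b)"
    and unit1_mor: "a \<in> ob B \<Longrightarrow> unit1 B a \<in> mor1 B a a"
    and ten_mor: "\<lbrakk>X \<in> mor1 B a b; Y \<in> mor1 B b c\<rbrakk> \<Longrightarrow> X \<otimes> Y \<in> mor1 B a c"
    and hten_hom: "\<lbrakk>X \<in> mor1 B a b; X' \<in> mor1 B a b; Y \<in> mor1 B b c; Y' \<in> mor1 B b c;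
          f \<in> hom B X X'; g \<in> hom B Y Y'\<rbrakk> \<Longrightarrow> hten B X X' Y Y' f g \<in> hom B (X \<otimes> Y) (X' \<otimes> Y')"
    and hten_idn: "\<lbrakk>X \<in> mor1 B a b; Y \<in> mor1 B b c\<rbrakk>
          \<Longrightarrow> hten B X X Y Y (idn B X) (idn B Y) = idn B (X \<otimes> Y)"
    and hten_cmp: "\<lbrakk>X \<in> mor1 B a b; X' \<in> mor1 B a b; X'' \<in> mor1 B a b;
          Y \<in> mor1 B b c; Y' \<in> mor1 B b c; Y'' \<in> mor1 B b c;
          f \<in> hom B X X'; f' \<in> hom B X' X''; g \<in> hom B Y Y'; g' \<in> hom B Y' Y''\<rbrakk>
          \<Longrightarrow> hten B X X'' Y Y'' (f' \<cdot> f) (g' \<cdot> g) = hten B X' X'' Y' Y'' f' g' \<cdot> hten B X X' Y Y' f g"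
    and hten_add_left: "\<lbrakk>X \<in> mor1 B a b; X' \<in> mor1 B a b; Y \<in> mor1 B b c; Y' \<in> mor1 B b c;
          f \<in> hom B X X'; f' \<in> hom B X X'; g \<in> hom B Y Y'\<rbrakk>
          \<Longrightarrow> hten B X X' Y Y' (f + f') g = hten B X X' Y Y' f g + hten B X X' Y Y' f' g"
    and hten_add_right: "\<lbrakk>X \<in> mor1 B a b; X' \<in> mor1 B a b; Y \<in> mor1 B b c; Y' \<in> mor1 B b c;
          f \<in> hom B X X'; g \<in> hom B Y Y'; g' \<in> hom B Y Y'\<rbrakk>
          \<Longrightarrow> hten B X X' Y Y' f (g + g') = hten B X X' Y Y' f g + hten B X X' Y Y' f g'"
    and hten_scal_left: "\<lbrakk>X \<in> mor1 B a b; X' \<in> mor1 B a b; Y \<in> mor1 B b c; Y' \<in> mor1 B b c;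
          f \<in> hom B X X'; g \<in> hom B Y Y'\<rbrakk>
          \<Longrightarrow> hten B X X' Y Y' (scal B t f) g = scal B t (hten B X X' Y Y' f g)"
    and hten_scal_right: "\<lbrakk>X \<in> mor1 B a b; X' \<in> mor1 B a b; Y \<in> mor1 B b c; Y' \<in> mor1 B b c;
          f \<in> hom B X X'; g \<in> hom B Y Y'\<rbrakk>
          \<Longrightarrow> hten B X X' Y Y' f (scal B t g) = scal B t (hten B X X' Y Y' f g)"
    and hten_dag: "\<lbrakk>X \<in> mor1 B a b; X' \<in> mor1 B a b; Y \<in> mor1 B b c; Y' \<in> mor1 B b c;
          f \<in> hom B X X'; g \<in> hom B Y Y'\<rbrakk>
          \<Longrightarrow> dag B (hten B X X' Y Y' f g) = hten B X' X Y' Y (dag B f) (dag B g)"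
    and assoc_unitary: "\<lbrakk>X \<in> mor1 B a b; Y \<in> mor1 B b c; Z \<in> mor1 B c d\<rbrakk>
          \<Longrightarrow> unitary B (X \<otimes> Y \<otimes> Z) (X \<otimes> (Y \<otimes> Z)) (assoc B X Y Z)"
    and assoc_natural: "\<lbrakk>X \<in> mor1 B a b; X' \<in> mor1 B a b; Y \<in> mor1 B b c; Y' \<in> mor1 B b c;
          Z \<in> mor1 B c d; Z' \<in> mor1 B c d; f \<in> hom B X X'; g \<in> hom B Y Y'; h \<in> hom B Z Z'\<rbrakk>
          \<Longrightarrow> assoc B X' Y' Z' \<cdot> hten B (X \<otimes> Y) (X' \<otimes> Y') Z Z' (hten B X X' Y Y' f g) h
              = hten B X X' (Y \<otimes> Z) (Y' \<otimes> Z') f (hten B Y Y' Z Z' g h) \<cdot> assoc B X Y Z"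
    and lunit_unitary: "X \<in> mor1 B a b \<Longrightarrow> unitary B (unit1 B a \<otimes> X) X (lunit B X)"
    and lunit_natural: "\<lbrakk>X \<in> mor1 B a b; X' \<in> mor1 B a b; f \<in> hom B X X'\<rbrakk>
          \<Longrightarrow> lunit B X' \<cdot> lwh B (unit1 B a) X X' f = f \<cdot> lunit B X"
    and runit_unitary: "X \<in> mor1 B a b \<Longrightarrow> unitary B (X \<otimes> unit1 B b) X (runit B X)"
    and runit_natural: "\<lbrakk>X \<in> mor1 B a b; X' \<in> mor1 B a b; f \<in> hom B X X'\<rbrakk>
          \<Longrightarrow> runit B X' \<cdot> rwh B X X' (unit1 B b) f = f \<cdot> runit B X"
    and pentagon: "\<lbrakk>W \<in> mor1 B a b; X \<in> mor1 B b c; Y \<in> mor1 B c d; Z \<in> mor1 B d e\<rbrakk>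
          \<Longrightarrow> lwh B W (X \<otimes> Y \<otimes> Z) (X \<otimes> (Y \<otimes> Z)) (assoc B X Y Z) \<cdot> assoc B W (X \<otimes> Y) Z \<cdot>
                rwh B (W \<otimes> X \<otimes> Y) (W \<otimes> (X \<otimes> Y)) Z (assoc B W X Y)
              = assoc B W X (Y \<otimes> Z) \<cdot> assoc B (W \<otimes> X) Y Z"
    and triangle: "\<lbrakk>X \<in> mor1 B a b; Y \<in> mor1 B b c\<rbrakk>
          \<Longrightarrow> lwh B X (unit1 B b \<otimes> Y) Y (lunit B Y) \<cdot> assoc B X (unit1 B b) Y
              = rwh B (X \<otimes> unit1 B b) X Y (runit B X)"

context
  fixes B :: "('o, 'm, 'c::ab_group_add, 'z) bicat_scheme" (structure)
begin

text \<open>\<open>X'\<close> is an adjoint of \<open>X : a \<rightarrow> b\<close> with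
  \<open>e : X' \<otimes> X \<Rightarrow> 1\<^sub>b\<close> and \<open>d : 1\<^sub>a \<Rightarrow> X \<otimes> X'\<close>.
  Inverses of associators and unitors are written as daggers.\<close>

definition is_adjoint :: "'o \<Rightarrow> 'o \<Rightarrow> 'm \<Rightarrow> 'm \<Rightarrow> 'c \<Rightarrow> 'c \<Rightarrow> bool" where
  "is_adjoint a b X X' e d \<longleftrightarrow>
     X \<in> mor1 B a b \<and> X' \<in> mor1 B b a \<and>
     e \<in> hom B (X' \<otimes> X) (unit1 B b) \<and> d \<in> hom B (unit1 B a) (X \<otimes> X') \<and>
     runit B X \<cdot> lwh B X (X' \<otimes> X) (unit1 B b) e \<cdot> assoc B X X' X \<cdot>
       rwh B (unit1 B a) (X \<otimes> X') X d \<cdot> dag B (lunit B X) = idn B X \<and>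
     lunit B X' \<cdot> rwh B (X' \<otimes> X) (unit1 B b) X' e \<cdot> dag B (assoc B X' X X') \<cdot>
       lwh B X' (unit1 B a) (X \<otimes> X') d \<cdot> dag B (runit B X') = idn B X'"

definition rigid :: bool where
  "rigid \<longleftrightarrow> (\<forall>a\<in>ob B. \<forall>b\<in>ob B. \<forall>X\<in>mor1 B a b.
     (\<exists>X' e d. is_adjoint a b X X' e d) \<and> (\<exists>X' e d. is_adjoint b a X' X e d))"

end


section \<open>Multitensor categories, Drinfeld centers, linking categories\<close>

text \<open>A tensor category is a 2-category with the single 0-cell \<^term>\<open>()\<close>.\<close>

definition unitary_multitensor :: "(unit, 'm, 'c::ab_group_add, 'z) bicat_scheme \<Rightarrow> bool" where
  "unitary_multitensor L \<longleftrightarrow> ob L = {()} \<and> cstar_2category L \<and> semisimple (homcat L () ()) \<and> rigid L"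

definition unitary_multifusion :: "(unit, 'm, 'c::ab_group_add, 'z) bicat_scheme \<Rightarrow> bool" where
  "unitary_multifusion L \<longleftrightarrow> unitary_multitensor L \<and> finitely_semisimple (homcat L () ())"

context
  fixes L :: "(unit, 'm, 'c::ab_group_add, 'z) bicat_scheme" (structure)
begin

definition center_objs :: "('m \<times> ('m \<Rightarrow> 'c)) set" where
  "center_objs = {(Z, \<sigma>). Z \<in> objs L \<and>
     (\<forall>X\<in>objs L. invertible L (X \<otimes> Z) (Z \<otimes> X) (\<sigma> X)) \<and>
     (\<forall>X\<in>objs L. \<forall>Y\<in>objs L. \<forall>f\<in>hom L X Y. \<sigma> Y \<cdot> rwh L X Y Z f = lwh L Z X Y f \<cdot> \<sigma> X) \<and>
     (\<forall>X\<in>objs L. \<forall>Y\<in>objs L.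
        \<sigma> (X \<otimes> Y) = assoc L Z X Y \<cdot> rwh L (X \<otimes> Z) (Z \<otimes> X) Y (\<sigma> X) \<cdot>
          dag L (assoc L X Z Y) \<cdot> lwh L X (Y \<otimes> Z) (Z \<otimes> Y) (\<sigma> Y) \<cdot> assoc L X Y Z)}"

definition center_hom :: "('m \<times> ('m \<Rightarrow> 'c)) \<Rightarrow> ('m \<times> ('m \<Rightarrow> 'c)) \<Rightarrow> 'c set" where
  "center_hom P Q = {f \<in> hom L (fst P) (fst Q). P \<in> center_objs \<and> Q \<in> center_objs \<and>
     (\<forall>X\<in>objs L. snd Q X \<cdot> lwh L X (fst P) (fst Q) f = rwh L (fst P) (fst Q) X f \<cdot> snd P X)}"

definition center_unit :: "'m \<times> ('m \<Rightarrow> 'c)" where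
  "center_unit = (unit1 L (), \<lambda>X. dag L (lunit L X) \<cdot> runit L X)"

end

context
  fixes B :: "('o, 'm, 'c::ab_group_add, 'z) bicat_scheme" (structure)
begin

text \<open>
  Matrix multiplication of 1-morphisms needs direct sums in the hom-categories, which are unique
  up to unique compatible unitary; \<open>chosen_sum\<close> fixes one, with its inclusions.
\<close>

definition chosen_sum :: "'o \<Rightarrow> 'o \<Rightarrow> nat \<Rightarrow> (nat \<Rightarrow> 'm) \<Rightarrow> 'm \<times> (nat \<Rightarrow> 'c)" where
  "chosen_sum a b n Xs = (SOME (S, \<iota>). orth_sum (homcat B a b) n Xs S \<iota>)"

definition zero1 :: "'o \<Rightarrow> 'o \<Rightarrow> 'm" where
  "zero1 a b = (SOME Z. Z \<in> mor1 B a b \<and> idn B Z = 0)"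

definition link_unit :: "'o list \<Rightarrow> nat \<Rightarrow> nat \<Rightarrow> 'm" where
  "link_unit as = (\<lambda>i j. if i < length as \<and> j < length as
     then (if i = j then unit1 B (as!i) else zero1 (as!i) (as!j)) else undefined)"

definition link_ten :: "'o list \<Rightarrow> (nat \<Rightarrow> nat \<Rightarrow> 'm) \<Rightarrow> (nat \<Rightarrow> nat \<Rightarrow> 'm) \<Rightarrow> nat \<Rightarrow> nat \<Rightarrow> 'm" where
  "link_ten as X Y = (\<lambda>i k. if i < length as \<and> k < length as
     then fst (chosen_sum (as!i) (as!k) (length as) (\<lambda>j. X i j \<otimes> Y j k)) else undefined)"

text \<open>\<open>link_inc as X Y i k j\<close> is the inclusion
  \<open>X\<^sub>i\<^sub>j \<otimes> Y\<^sub>j\<^sub>k \<Rightarrow> (X \<otimes> Y)\<^sub>i\<^sub>k\<close>.\<close>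

definition link_inc ::
  "'o list \<Rightarrow> (nat \<Rightarrow> nat \<Rightarrow> 'm) \<Rightarrow> (nat \<Rightarrow> nat \<Rightarrow> 'm) \<Rightarrow> nat \<Rightarrow> nat \<Rightarrow> nat \<Rightarrow> 'c" where
  "link_inc as X Y i k = snd (chosen_sum (as!i) (as!k) (length as) (\<lambda>j. X i j \<otimes> Y j k))"

text \<open>
  Objects are square matrices, indexed so that the \<open>(i,j)\<close> entry goes from
  \<open>a\<^sub>i\<close> to \<open>a\<^sub>j\<close>; since \<open>\<otimes>\<close> composes from left to right this makes
  the tensor product row-by-column multiplication.  (Transposing the indices yields the same
  category with reversed tensor product, which affects none of the properties used.)
  Entries outside the matrix are a fixed dummy value.
\<close>

definition linking :: "'o list \<Rightarrow> (unit, nat \<Rightarrow> nat \<Rightarrow> 'm, nat \<Rightarrow> nat \<Rightarrow> 'c) bicat" where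
  "linking as =
     (let n = length as; inc = link_inc as; T = link_ten as in
      \<lparr>objs = {X. \<forall>i j. if i < n \<and> j < n then X i j \<in> mor1 B (as!i) (as!j) else X i j = undefined},
       hom = (\<lambda>X Y. {f. \<forall>i j. if i < n \<and> j < n then f i j \<in> hom B (X i j) (Y i j) else f i j = 0}),
       scal = (\<lambda>t f i j. scal B t (f i j)),
       idn = (\<lambda>X i j. if i < n \<and> j < n then idn B (X i j) else 0),
       cmp = (\<lambda>g f i j. if i < n \<and> j < n then g i j \<cdot> f i j else 0),
       dag = (\<lambda>f i j. if i < n \<and> j < n then dag B (f i j) else 0),
       ob = {()}, src = (\<lambda>_. ()), tgt = (\<lambda>_. ()),
       unit1 = (\<lambda>_. link_unit as),
       ten = T,
       hten = (\<lambda>X X' Y Y' f g i k. if i < n \<and> k < n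
                 then \<Sum>j<n. inc X' Y' i k j \<cdot> hten B (X i j) (X' i j) (Y j k) (Y' j k) (f i j) (g j k) \<cdot>
                        dag B (inc X Y i k j)
                 else 0),
       assoc = (\<lambda>X Y Z i l. if i < n \<and> l < n
                 then \<Sum>j<n. \<Sum>k<n.
                        inc X (T Y Z) i l j \<cdot>
                        lwh B (X i j) (Y j k \<otimes> Z k l) (T Y Z j l) (inc Y Z j l k) \<cdot>
                        assoc B (X i j) (Y j k) (Z k l) \<cdot>
                        rwh B (T X Y i k) (X i j \<otimes> Y j k) (Z k l) (dag B (inc X Y i k j)) \<cdot>
                        dag B (inc (T X Y) Z i l k)
                 else 0),
       lunit = (\<lambda>X i j. if i < n \<and> j < n
                 then lunit B (X i j) \<cdot> dag B (inc (link_unit as) X i j i)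
                 else 0),
       runit = (\<lambda>X i j. if i < n \<and> j < n
                 then runit B (X i j) \<cdot> dag B (inc X (link_unit as) i j j)
                 else 0)\<rparr>)"

definition unitary_2category :: bool where
  "unitary_2category \<longleftrightarrow> cstar_2category B \<and>
     (\<forall>as. as \<noteq> [] \<and> set as \<subseteq> ob B \<longrightarrow> unitary_multitensor (linking as))"

definition finite_unitary_2category :: bool where
  "finite_unitary_2category \<longleftrightarrow> unitary_2category \<and>
     (\<forall>as. as \<noteq> [] \<and> set as \<subseteq> ob B \<longrightarrow> unitary_multifusion (linking as)) \<and>
     (\<exists>N. \<forall>as. as \<noteq> [] \<and> set as \<subseteq> ob B \<longrightarrow>
        vector_space.dim (scal (linking as))
          (center_hom (linking as) (center_unit (linking as)) (center_unit (linking as))) \<le> N)"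

end


section \<open>Unitary adjoint functors, spherical weights, 3-Hilbert spaces\<close>

record ('m, 'c) adjoint_choice =
  dual :: "'m \<Rightarrow> 'm"
  ev :: "'m \<Rightarrow> 'c"
  coev :: "'m \<Rightarrow> 'c"

context
  fixes B :: "('o, 'm, 'c::ab_group_add, 'z) bicat_scheme" (structure)
    and D :: "('m, 'c) adjoint_choice"
begin

text \<open>The 2-morphism \<open>P \<Rightarrow> Z\<^sup>\<or>\<close> corresponding to
  \<open>e : P \<otimes> Z \<Rightarrow> 1\<^sub>b\<close>, for \<open>Z : a \<rightarrow> b\<close> and \<open>P : b \<rightarrow> a\<close>.\<close>

definition transpose_to_dual :: "'m \<Rightarrow> 'm \<Rightarrow> 'c \<Rightarrow> 'c" where
  "transpose_to_dual P Z e =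
     lunit B (dual D Z) \<cdot> rwh B (P \<otimes> Z) (unit1 B (tgt B Z)) (dual D Z) e \<cdot>
     dag B (assoc B P Z (dual D Z)) \<cdot>
     lwh B P (unit1 B (src B Z)) (Z \<otimes> dual D Z) (coev D Z) \<cdot> dag B (runit B P)"

text \<open>\<open>f\<^sup>\<or> : Y\<^sup>\<or> \<Rightarrow> X\<^sup>\<or>\<close> for \<open>f : X \<Rightarrow> Y\<close>.\<close>

definition dual2 :: "'m \<Rightarrow> 'm \<Rightarrow> 'c \<Rightarrow> 'c" where
  "dual2 X Y f = transpose_to_dual (dual D Y) X (ev D Y \<cdot> lwh B (dual D Y) X Y f)"

definition dual_unit_map :: "'o \<Rightarrow> 'c" where
  "dual_unit_map a = ev D (unit1 B a) \<cdot> dag B (runit B (dual D (unit1 B a)))"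

text \<open>The canonical map \<open>X\<^sup>\<or> \<otimes> Y\<^sup>\<or> \<Rightarrow> (Y \<otimes> X)\<^sup>\<or>\<close>, induced by the nested evaluation
  \<open>(X\<^sup>\<or> \<otimes> Y\<^sup>\<or>) \<otimes> (Y \<otimes> X) \<Rightarrow> 1\<close>.\<close>

definition dual_ten_map :: "'m \<Rightarrow> 'm \<Rightarrow> 'c" where
  "dual_ten_map X Y = transpose_to_dual (dual D X \<otimes> dual D Y) (Y \<otimes> X)
     (ev D X \<cdot> lwh B (dual D X) (dual D Y \<otimes> (Y \<otimes> X)) X
        (lunit B X \<cdot> rwh B (dual D Y \<otimes> Y) (unit1 B (tgt B Y)) X (ev D Y) \<cdot>
         dag B (assoc B (dual D Y) Y X)) \<cdot>
      assoc B (dual D X) (dual D Y) (Y \<otimes> X))"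

definition unitary_adjoint_functor :: bool where
  "unitary_adjoint_functor \<longleftrightarrow>
     (\<forall>a\<in>ob B. \<forall>b\<in>ob B. \<forall>X\<in>mor1 B a b. is_adjoint B a b X (dual D X) (ev D X) (coev D X)) \<and>
     (\<forall>a\<in>ob B. unitary B (dual D (unit1 B a)) (unit1 B a) (dual_unit_map a)) \<and>
     (\<forall>a\<in>ob B. \<forall>b\<in>ob B. \<forall>c\<in>ob B. \<forall>Y\<in>mor1 B a b. \<forall>X\<in>mor1 B b c.
        unitary B (dual D X \<otimes> dual D Y) (dual D (Y \<otimes> X)) (dual_ten_map X Y)) \<and>
     (\<forall>a\<in>ob B. \<forall>b\<in>ob B. \<forall>X\<in>mor1 B a b. \<forall>Y\<in>mor1 B a b. \<forall>f\<in>hom B X Y.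
        dag B (dual2 X Y f) = dual2 Y X (dag B f))"

definition left_trace :: "'m \<Rightarrow> 'c \<Rightarrow> 'c" where
  "left_trace X f = dag B (coev D X) \<cdot> rwh B X X (dual D X) f \<cdot> coev D X"

definition right_trace :: "'m \<Rightarrow> 'c \<Rightarrow> 'c" where
  "right_trace X f = ev D X \<cdot> lwh B (dual D X) X X f \<cdot> dag B (ev D X)"

definition spherical_weight :: "('o \<Rightarrow> 'c \<Rightarrow> complex) \<Rightarrow> bool" where
  "spherical_weight \<Psi> \<longleftrightarrow>
     (\<forall>a\<in>ob B. faithful_positive_functional B (unit1 B a) (\<Psi> a)) \<and>
     (\<forall>a\<in>ob B. \<forall>b\<in>ob B. \<forall>X\<in>mor1 B a b. \<forall>f\<in>hom B X X.
        \<Psi> a (left_trace X f) = \<Psi> b (right_trace X f))"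

definition weight_trace :: "('o \<Rightarrow> 'c \<Rightarrow> complex) \<Rightarrow> 'm \<Rightarrow> 'c \<Rightarrow> complex" where
  "weight_trace \<Psi> X f = \<Psi> (src B X) (left_trace X f)"

definition pre_3_hilbert_space :: "('o \<Rightarrow> 'c \<Rightarrow> complex) \<Rightarrow> bool" where
  "pre_3_hilbert_space \<Psi> \<longleftrightarrow>
     finite_unitary_2category B \<and> unitary_adjoint_functor \<and> spherical_weight \<Psi>"

definition isometry1 :: "'o \<Rightarrow> 'o \<Rightarrow> 'm \<Rightarrow> bool" where
  "isometry1 a b X \<longleftrightarrow> X \<in> mor1 B a b \<and>
     unitary B (unit1 B a) (X \<otimes> dual D X) (coev D X) \<and>
     isometric B (dual D X \<otimes> X) (unit1 B b) (ev D X)"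

definition isometric_equivalence1 :: "'o \<Rightarrow> 'o \<Rightarrow> 'm \<Rightarrow> bool" where
  "isometric_equivalence1 a b X \<longleftrightarrow> X \<in> mor1 B a b \<and>
     unitary B (unit1 B a) (X \<otimes> dual D X) (coev D X) \<and>
     unitary B (dual D X \<otimes> X) (unit1 B b) (ev D X)"

definition hilbert_direct_sum :: "'o \<Rightarrow> 'o \<Rightarrow> 'o \<Rightarrow> 'm \<Rightarrow> 'm \<Rightarrow> bool" where
  "hilbert_direct_sum a b s I J \<longleftrightarrow> s \<in> ob B \<and> isometry1 a s I \<and> isometry1 b s J \<and>
     ev D I \<cdot> dag B (ev D I) + ev D J \<cdot> dag B (ev D J) = idn B (unit1 B s)"

text \<open>\<open>\<mu>\<^sup>\<dagger>\<close> is a bimodule map for the actions of \<open>A\<close> on the outer factors of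
  \<open>A \<otimes> A\<close>: the last two equations before the invertibility of \<open>\<mu>\<mu>\<^sup>\<dagger>\<close>.\<close>

definition hstar_monad :: "('o \<Rightarrow> 'c \<Rightarrow> complex) \<Rightarrow> 'o \<Rightarrow> 'm \<Rightarrow> 'c \<Rightarrow> 'c \<Rightarrow> bool" where
  "hstar_monad \<Psi> a A \<mu> \<iota> \<longleftrightarrow>
     A \<in> mor1 B a a \<and> \<mu> \<in> hom B (A \<otimes> A) A \<and> \<iota> \<in> hom B (unit1 B a) A \<and>
     \<mu> \<cdot> rwh B (A \<otimes> A) A A \<mu> = \<mu> \<cdot> lwh B A (A \<otimes> A) A \<mu> \<cdot> assoc B A A A \<and>
     \<mu> \<cdot> rwh B (unit1 B a) A A \<iota> = lunit B A \<and>
     \<mu> \<cdot> lwh B A (unit1 B a) A \<iota> = runit B A \<and>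
     dag B \<mu> \<cdot> \<mu> = rwh B (A \<otimes> A) A A \<mu> \<cdot> dag B (assoc B A A A) \<cdot> lwh B A A (A \<otimes> A) (dag B \<mu>) \<and>
     dag B \<mu> \<cdot> \<mu> = lwh B A (A \<otimes> A) A \<mu> \<cdot> assoc B A A A \<cdot> rwh B A (A \<otimes> A) A (dag B \<mu>) \<and>
     invertible B A A (\<mu> \<cdot> dag B \<mu>) \<and>
     (\<forall>f\<in>hom B A A.
        \<Psi> a (dag B \<iota> \<cdot> \<mu> \<cdot> lwh B A A A f \<cdot> dag B \<mu> \<cdot> \<iota>) =
        \<Psi> a (dag B \<iota> \<cdot> \<mu> \<cdot> rwh B A A A f \<cdot> dag B \<mu> \<cdot> \<iota>))"

text \<open>The multiplication \<open>1 \<otimes> ev\<^sub>X \<otimes> 1\<close> of the algebra \<open>X \<otimes> X\<^sup>\<or>\<close>, whose unit is \<open>coev\<^sub>X\<close>.\<close>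

definition pair_mult :: "'m \<Rightarrow> 'c" where
  "pair_mult X =
     lwh B X (dual D X \<otimes> (X \<otimes> dual D X)) (dual D X)
       (lunit B (dual D X) \<cdot> rwh B (dual D X \<otimes> X) (unit1 B (tgt B X)) (dual D X) (ev D X) \<cdot>
        dag B (assoc B (dual D X) X (dual D X))) \<cdot>
     assoc B X (dual D X) (X \<otimes> dual D X)"

definition monad_splits :: "'o \<Rightarrow> 'm \<Rightarrow> 'c \<Rightarrow> 'c \<Rightarrow> bool" where
  "monad_splits a A \<mu> \<iota> \<longleftrightarrow>
     (\<exists>b\<in>ob B. \<exists>X\<in>mor1 B a b. \<exists>u.
        invertible B (unit1 B b) (unit1 B b) (ev D X \<cdot> dag B (ev D X)) \<and>
        unitary B A (X \<otimes> dual D X) u \<and>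
        u \<cdot> \<mu> = pair_mult X \<cdot> hten B A (X \<otimes> dual D X) A (X \<otimes> dual D X) u u \<and>
        u \<cdot> \<iota> = coev D X)"

text \<open>Binary Hilbert direct sums yield those of all finite nonempty families.\<close>

definition three_hilbert_space :: "('o \<Rightarrow> 'c \<Rightarrow> complex) \<Rightarrow> bool" where
  "three_hilbert_space \<Psi> \<longleftrightarrow> pre_3_hilbert_space \<Psi> \<and>
     (\<forall>a\<in>ob B. \<forall>b\<in>ob B. \<exists>s I J. hilbert_direct_sum a b s I J) \<and>
     (\<forall>a\<in>ob B. \<forall>A \<mu> \<iota>. hstar_monad \<Psi> a A \<mu> \<iota> \<longrightarrow> monad_splits a A \<mu> \<iota>)"

end


section \<open>Natural transformations between representable 2-functors\<close>

text \<open>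
  The 2-functor \<open>\<XX>(- \<rightarrow> a)\<close> sends a 1-morphism \<open>Y : c \<rightarrow> d\<close> to
  \<open>Y \<otimes> - : \<XX>(d \<rightarrow> a) \<rightarrow> \<XX>(c \<rightarrow> a)\<close> and a 2-morphism \<open>f\<close> to
  \<open>f \<otimes> -\<close>; its coherence 2-cells are given by associators and left unitors.
  A transformation \<open>\<XX>(- \<rightarrow> a) \<Rightarrow> \<XX>(- \<rightarrow> b)\<close> has as component at \<open>c\<close>
  the functor with object map \<open>tobj \<theta> c\<close> and action \<open>tmap \<theta> c Z Z'\<close>
  on \<open>hom Z Z'\<close>, and naturators
  \<open>tnat \<theta> Y Z : \<theta>\<^sub>c (Y \<otimes> Z) \<Rightarrow> Y \<otimes> \<theta>\<^sub>d Z\<close>.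
\<close>

record ('o, 'm, 'c) transf =
  tobj :: "'o \<Rightarrow> 'm \<Rightarrow> 'm"
  tmap :: "'o \<Rightarrow> 'm \<Rightarrow> 'm \<Rightarrow> 'c \<Rightarrow> 'c"
  tnat :: "'m \<Rightarrow> 'm \<Rightarrow> 'c"

context
  fixes B :: "('o, 'm, 'c::ab_group_add, 'z) bicat_scheme" (structure)
begin

definition unitary_transformation :: "'o \<Rightarrow> 'o \<Rightarrow> ('o, 'm, 'c) transf \<Rightarrow> bool" where
  "unitary_transformation a b \<theta> \<longleftrightarrow>
     (\<forall>c\<in>ob B. linear_dagger_functor (homcat B c a) (homcat B c b) (tobj \<theta> c) (tmap \<theta> c)) \<and>
     (\<forall>c\<in>ob B. \<forall>d\<in>ob B. \<forall>Y\<in>mor1 B c d. \<forall>Z\<in>mor1 B d a.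
        unitary B (tobj \<theta> c (Y \<otimes> Z)) (Y \<otimes> tobj \<theta> d Z) (tnat \<theta> Y Z)) \<and>
     (\<forall>c\<in>ob B. \<forall>d\<in>ob B. \<forall>Y\<in>mor1 B c d. \<forall>Z\<in>mor1 B d a. \<forall>Z'\<in>mor1 B d a. \<forall>g\<in>hom B Z Z'.
        tnat \<theta> Y Z' \<cdot> tmap \<theta> c (Y \<otimes> Z) (Y \<otimes> Z') (lwh B Y Z Z' g) =
        lwh B Y (tobj \<theta> d Z) (tobj \<theta> d Z') (tmap \<theta> d Z Z' g) \<cdot> tnat \<theta> Y Z) \<and>
     (\<forall>c\<in>ob B. \<forall>d\<in>ob B. \<forall>Y\<in>mor1 B c d. \<forall>Y'\<in>mor1 B c d. \<forall>Z\<in>mor1 B d a. \<forall>f\<in>hom B Y Y'.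
        tnat \<theta> Y' Z \<cdot> tmap \<theta> c (Y \<otimes> Z) (Y' \<otimes> Z) (rwh B Y Y' Z f) =
        rwh B Y Y' (tobj \<theta> d Z) f \<cdot> tnat \<theta> Y Z) \<and>
     (\<forall>c\<in>ob B. \<forall>d\<in>ob B. \<forall>e\<in>ob B. \<forall>Y\<in>mor1 B c d. \<forall>Y'\<in>mor1 B d e. \<forall>Z\<in>mor1 B e a.
        assoc B Y Y' (tobj \<theta> e Z) \<cdot> tnat \<theta> (Y \<otimes> Y') Z =
        lwh B Y (tobj \<theta> d (Y' \<otimes> Z)) (Y' \<otimes> tobj \<theta> e Z) (tnat \<theta> Y' Z) \<cdot> tnat \<theta> Y (Y' \<otimes> Z) \<cdot>
        tmap \<theta> c (Y \<otimes> Y' \<otimes> Z) (Y \<otimes> (Y' \<otimes> Z)) (assoc B Y Y' Z)) \<and>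
     (\<forall>c\<in>ob B. \<forall>Z\<in>mor1 B c a.
        lunit B (tobj \<theta> c Z) \<cdot> tnat \<theta> (unit1 B c) Z =
        tmap \<theta> c (unit1 B c \<otimes> Z) Z (lunit B Z))"

definition transf_id :: "('o, 'm, 'c) transf" where
  "transf_id = \<lparr>tobj = (\<lambda>c Z. Z), tmap = (\<lambda>c Z Z' f. f), tnat = (\<lambda>Y Z. idn B (Y \<otimes> Z))\<rparr>"

definition transf_comp :: "('o, 'm, 'c) transf \<Rightarrow> ('o, 'm, 'c) transf \<Rightarrow> ('o, 'm, 'c) transf" where
  "transf_comp \<psi> \<theta> =
     \<lparr>tobj = (\<lambda>c Z. tobj \<psi> c (tobj \<theta> c Z)),
      tmap = (\<lambda>c Z Z' f. tmap \<psi> c (tobj \<theta> c Z) (tobj \<theta> c Z') (tmap \<theta> c Z Z' f)),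
      tnat = (\<lambda>Y Z. tnat \<psi> Y (tobj \<theta> (tgt B Y) Z) \<cdot>
                tmap \<psi> (src B Y) (tobj \<theta> (src B Y) (Y \<otimes> Z)) (Y \<otimes> tobj \<theta> (tgt B Y) Z) (tnat \<theta> Y Z))\<rparr>"

text \<open>An invertible modification \<open>m\<close> from \<open>\<theta>\<close> to \<open>\<phi>\<close>, both
  transformations out of \<open>\<XX>(- \<rightarrow> a)\<close>.\<close>

definition invertible_modification ::
  "'o \<Rightarrow> ('o, 'm, 'c) transf \<Rightarrow> ('o, 'm, 'c) transf \<Rightarrow> ('o \<Rightarrow> 'm \<Rightarrow> 'c) \<Rightarrow> bool" where
  "invertible_modification a \<theta> \<phi> m \<longleftrightarrow>
     (\<forall>c\<in>ob B. \<forall>Z\<in>mor1 B c a. invertible B (tobj \<theta> c Z) (tobj \<phi> c Z) (m c Z)) \<and>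
     (\<forall>c\<in>ob B. \<forall>Z\<in>mor1 B c a. \<forall>Z'\<in>mor1 B c a. \<forall>g\<in>hom B Z Z'.
        m c Z' \<cdot> tmap \<theta> c Z Z' g = tmap \<phi> c Z Z' g \<cdot> m c Z) \<and>
     (\<forall>c\<in>ob B. \<forall>d\<in>ob B. \<forall>Y\<in>mor1 B c d. \<forall>Z\<in>mor1 B d a.
        tnat \<phi> Y Z \<cdot> m c (Y \<otimes> Z) =
        lwh B Y (tobj \<theta> d Z) (tobj \<phi> d Z) (m d Z) \<cdot> tnat \<theta> Y Z)"

definition natural_unitary_equivalence :: "'o \<Rightarrow> 'o \<Rightarrow> ('o, 'm, 'c) transf \<Rightarrow> bool" where
  "natural_unitary_equivalence a b \<theta> \<longleftrightarrow> unitary_transformation a b \<theta> \<and>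
     (\<exists>\<psi> m m'. unitary_transformation b a \<psi> \<and>
        invertible_modification a transf_id (transf_comp \<psi> \<theta>) m \<and>
        invertible_modification b (transf_comp \<theta> \<psi>) transf_id m')"

definition pointwise_isometric ::
  "('m, 'c) adjoint_choice \<Rightarrow> ('o \<Rightarrow> 'c \<Rightarrow> complex) \<Rightarrow> 'o \<Rightarrow> 'o \<Rightarrow> ('o, 'm, 'c) transf \<Rightarrow> bool" where
  "pointwise_isometric D \<Psi> a b \<theta> \<longleftrightarrow>
     (\<forall>c\<in>ob B. isometric_equivalence_2Hilb
        (homcat B c a) (weight_trace B D \<Psi>) (homcat B c b) (weight_trace B D \<Psi>)
        (tobj \<theta> c) (tmap \<theta> c))"

definition representing :: "'o \<Rightarrow> ('o, 'm, 'c) transf \<Rightarrow> 'm" where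
  "representing a \<theta> = tobj \<theta> a (unit1 B a)"

end

end

theory Submission
  imports Defs
begin

text \<open>
  Let \<open>X\<close> be the image of \<open>1\<^sub>a\<close> under \<open>\<theta>\<close>.  The naturators of \<open>\<theta>\<close> at \<open>Z \<otimes> 1\<^sub>a\<close> identify \<open>\<theta>\<close>
  with \<open>- \<otimes> X\<close> by unitaries, so every property of the components of \<open>\<theta>\<close> passes to tensoring with
  \<open>X\<close>: this functor is fully faithful, and since \<open>\<theta>\<close> preserves the traces and these are cyclic, it
  preserves traces.  The proof extracts the two unitarity statements from this.

  \<^item> \<open>coev\<close> is an isometry.  An endomorphism \<open>f\<close> of \<open>1\<^sub>a\<close> acts on \<open>X\<close> with trace
    \<open>\<Psi>\<^sub>a(coev\<^sup>\<dagger> coev f)\<close> (\<open>left_trace_unit_action\<close>), whereas its trace on \<open>1\<^sub>a\<close> itself is \<open>\<Psi>\<^sub>a(f)\<close>,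
    because the canonical map \<open>1\<^sub>a\<^sup>\<or> \<Rightarrow> 1\<^sub>a\<close> is unitary (\<open>unit1_coev_isometric\<close>).  Trace preservation
    equates the two, and faithfulness of \<open>\<Psi>\<^sub>a\<close> gives \<open>coev\<^sup>\<dagger> coev = 1\<close> (\<open>faithful_functional_unit\<close>).
  \<^item> \<open>coev\<close> is unitary.  The unit of the adjunction between \<open>- \<otimes> X\<close> and \<open>- \<otimes> X\<^sup>\<or>\<close> is
    invertible since \<open>- \<otimes> X\<close> is fully faithful, and an invertible isometry is unitary
    (\<open>coev_unitary\<close>).
  \<^item> \<open>ev\<close> is unitary.  By the first zig-zag equation \<open>X \<otimes> ev\<close> is, up to structure isomorphisms,
    inverse to the unitary \<open>coev \<otimes> X\<close>, so it is unitary too.  The functor \<open>X \<otimes> -\<close> is faithful, as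
    an inverse of \<open>\<theta>\<close> yields \<open>Y\<close> with \<open>Y \<otimes> X\<close> isomorphic to \<open>1\<^sub>b\<close>; hence \<open>ev\<close> is unitary
    (\<open>ev_unitary\<close>, \<open>left_whisker_faithful\<close>).
\<close>

section \<open>Dagger functors and dagger equivalences\<close>

lemma linear_dagger_functorD:
  assumes "linear_dagger_functor C D F0 F1"
  shows "X \<in> objs C \<Longrightarrow> F0 X \<in> objs D"
    and "X \<in> objs C \<Longrightarrow> F1 X X (idn C X) = idn D (F0 X)"
    and "\<lbrakk>X \<in> objs C; Y \<in> objs C; f \<in> hom C X Y\<rbrakk> \<Longrightarrow> F1 X Y f \<in> hom D (F0 X) (F0 Y)"
    and "\<lbrakk>X \<in> objs C; Y \<in> objs C; f \<in> hom C X Y\<rbrakk> \<Longrightarrow> F1 Y X (dag C f) = dag D (F1 X Y f)"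
    and "\<lbrakk>X \<in> objs C; Y \<in> objs C; Z \<in> objs C; f \<in> hom C X Y; g \<in> hom C Y Z\<rbrakk>
      \<Longrightarrow> F1 X Z (cmp C g f) = cmp D (F1 Y Z g) (F1 X Y f)"
  using assms unfolding linear_dagger_functor_def by blast+

lemma (in dagger_category) unitary_cancel_hom:
  assumes "unitary C X Y u" "X \<in> objs C" "Y \<in> objs C" "Z \<in> objs C"
  shows "f \<in> hom C Z X \<Longrightarrow> dag C u \<cdot> (u \<cdot> f) = f"
    and "f \<in> hom C Y Z \<Longrightarrow> (f \<cdot> u) \<cdot> dag C u = f"
    and "f \<in> hom C Z Y \<Longrightarrow> u \<cdot> (dag C u \<cdot> f) = f"
proof -
  have u: "u \<in> hom C X Y" "dag C u \<in> hom C Y X" "dag C u \<cdot> u = idn C X" "u \<cdot> dag C u = idn C Y"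
    using assms dag_hom unfolding unitary_def by blast+
  show "dag C u \<cdot> (u \<cdot> f) = f" if f: "f \<in> hom C Z X"
    using cmp_assoc[OF assms(4,2,3,2) f u(1,2)] idn_cmp[OF assms(4,2) f] u(3) by simp
  show "(f \<cdot> u) \<cdot> dag C u = f" if f: "f \<in> hom C Y Z"
    using cmp_assoc[OF assms(3,2,3,4) u(2,1) f] cmp_idn[OF assms(3,4) f] u(4) by simp
  show "u \<cdot> (dag C u \<cdot> f) = f" if f: "f \<in> hom C Z Y"
    using cmp_assoc[OF assms(4,3,2,3) f u(2,1)] idn_cmp[OF assms(4,3) f] u(4) by simp
qed

text \<open>
  The usual argument: \<open>\<sigma>\<close> makes \<open>F\<close> faithful and \<open>\<tau>\<close> makes the inverse \<open>G\<close> faithful; then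
  \<open>\<sigma>\<^sup>\<dagger> (G h) \<sigma>\<close> is a preimage of \<open>h\<close>, since \<open>G\<close> identifies its image under \<open>F\<close> with \<open>h\<close>.
\<close>

lemma dagger_equivalence_fully_faithful:
  fixes C :: "('x, 'f::ab_group_add, 'z) dcat_scheme" and D :: "('y, 'g::ab_group_add, 'w) dcat_scheme"
  assumes C: "dagger_category C" and D: "dagger_category D" and eqv: "dagger_equivalence C D F0 F1"
    and X: "X \<in> objs C" and Y: "Y \<in> objs C"
  shows "bij_betw (F1 X Y) (hom C X Y) (hom D (F0 X) (F0 Y))"
proof -
  interpret C: dagger_category C by fact
  interpret D: dagger_category D by fact
  obtain G0 G1 \<sigma> \<tau> where F: "linear_dagger_functor C D F0 F1" and G: "linear_dagger_functor D C G0 G1"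
    and \<sigma>: "unitary_natural_iso C C (\<lambda>X. X) (\<lambda>X Y f. f)
          (\<lambda>X. G0 (F0 X)) (\<lambda>X Y f. G1 (F0 X) (F0 Y) (F1 X Y f)) \<sigma>"
    and \<tau>: "unitary_natural_iso D D (\<lambda>X. F0 (G0 X)) (\<lambda>X Y f. F1 (G0 X) (G0 Y) (G1 X Y f))
          (\<lambda>X. X) (\<lambda>X Y f. f) \<tau>"
    using eqv unfolding dagger_equivalence_def by blast
  note F0 = linear_dagger_functorD(1)[OF F] and F1 = linear_dagger_functorD(3)[OF F]
    and G0 = linear_dagger_functorD(1)[OF G] and G1 = linear_dagger_functorD(3)[OF G]
  have \<sigma>u: "unitary C Z (G0 (F0 Z)) (\<sigma> Z)" if "Z \<in> objs C" for Z
    using \<sigma> that unfolding unitary_natural_iso_def by blast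
  have \<sigma>n: "cmp C (\<sigma> Y) f = cmp C (G1 (F0 X) (F0 Y) (F1 X Y f)) (\<sigma> X)" if "f \<in> hom C X Y" for f
    using \<sigma> that X Y unfolding unitary_natural_iso_def by blast
  have \<tau>u: "unitary D (F0 (G0 Z)) Z (\<tau> Z)" if "Z \<in> objs D" for Z
    using \<tau> that unfolding unitary_natural_iso_def by blast
  have \<tau>n: "cmp D (\<tau> Z') (F1 (G0 Z) (G0 Z') (G1 Z Z' g)) = cmp D g (\<tau> Z)"
    if "Z \<in> objs D" "Z' \<in> objs D" "g \<in> hom D Z Z'" for Z Z' g
    using \<tau> that unfolding unitary_natural_iso_def by blast
  have rec: "cmp C (dag C (\<sigma> Y)) (cmp C (G1 (F0 X) (F0 Y) (F1 X Y f)) (\<sigma> X)) = f" if "f \<in> hom C X Y" for f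
    using C.unitary_cancel_hom(1)[OF \<sigma>u[OF Y] Y _ X that] F0 G0 X Y \<sigma>n[OF that] by simp
  have G_faithful: "g = g'" if "g \<in> hom D (F0 X) (F0 Y)" "g' \<in> hom D (F0 X) (F0 Y)"
      "G1 (F0 X) (F0 Y) g = G1 (F0 X) (F0 Y) g'" for g g'
  proof -
    have FX: "F0 X \<in> objs D" "F0 Y \<in> objs D" "F0 (G0 (F0 X)) \<in> objs D" using F0 G0 X Y by auto
    have "cmp D g (\<tau> (F0 X)) = cmp D g' (\<tau> (F0 X))"
      using \<tau>n[OF FX(1,2) that(1)] \<tau>n[OF FX(1,2) that(2)] that(3) by simp
    thus ?thesis
      using D.unitary_cancel_hom(2)[OF \<tau>u[OF FX(1)] FX(3,1,2)] that by metis
  qed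
  show ?thesis
  proof (rule bij_betw_imageI)
    show "inj_on (F1 X Y) (hom C X Y)"
      by (rule inj_onI) (metis rec)
    show "F1 X Y ` hom C X Y = hom D (F0 X) (F0 Y)"
    proof (intro equalityI subsetI)
      fix h assume h: "h \<in> hom D (F0 X) (F0 Y)"
      have obs: "F0 X \<in> objs D" "F0 Y \<in> objs D" "G0 (F0 X) \<in> objs C" "G0 (F0 Y) \<in> objs C"
        using F0 G0 X Y by auto
      have Gh: "G1 (F0 X) (F0 Y) h \<in> hom C (G0 (F0 X)) (G0 (F0 Y))" using G1 obs h by simp
      have sX: "\<sigma> X \<in> hom C X (G0 (F0 X))" "\<sigma> Y \<in> hom C Y (G0 (F0 Y))"
        using \<sigma>u X Y unfolding unitary_def by auto
      have GhX: "cmp C (G1 (F0 X) (F0 Y) h) (\<sigma> X) \<in> hom C X (G0 (F0 Y))"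
        using C.cmp_hom[OF X obs(3,4) sX(1) Gh] .
      define f where "f = cmp C (dag C (\<sigma> Y)) (cmp C (G1 (F0 X) (F0 Y) h) (\<sigma> X))"
      have f: "f \<in> hom C X Y"
        unfolding f_def using C.cmp_hom[OF X obs(4) Y GhX C.dag_hom[OF Y obs(4) sX(2)]] .
      have FG: "G1 (F0 X) (F0 Y) (F1 X Y f) \<in> hom C (G0 (F0 X)) (G0 (F0 Y))" using G1 obs F1 X Y f by simp
      have "cmp C (G1 (F0 X) (F0 Y) (F1 X Y f)) (\<sigma> X) = cmp C (G1 (F0 X) (F0 Y) h) (\<sigma> X)"
        using \<sigma>n[OF f] C.unitary_cancel_hom(3)[OF \<sigma>u[OF Y] Y obs(4) X GhX] by (simp add: f_def)
      hence "G1 (F0 X) (F0 Y) (F1 X Y f) = G1 (F0 X) (F0 Y) h"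
        using C.unitary_cancel_hom(2)[OF \<sigma>u[OF X] X obs(3,4)] FG Gh by metis
      hence "F1 X Y f = h" using G_faithful F1 X Y f h by blast
      thus "h \<in> F1 X Y ` hom C X Y" using f by blast
    qed (use F1 X Y in auto)
  qed
qed

section \<open>Calculating with 2-morphisms\<close>

lemma homcat_simps [simp]:
  "objs (homcat B a b) = mor1 B a b" "hom (homcat B a b) = hom B"
  "scal (homcat B a b) = scal B" "idn (homcat B a b) = idn B"
  "cmp (homcat B a b) = cmp B" "dag (homcat B a b) = dag B"
  by (simp_all add: homcat_def dcat.defs)

text \<open>
  Hom-spaces may overlap, so a 2-morphism alone does not determine its boundary, and the operations
  take source and target as arguments.  Attaching them to the 2-morphism makes composition
  and tensor product binary operations whose laws the simplifier can apply.
\<close>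

datatype ('m, 'c) cell = Cell (dm: 'm) (val: 'c) (cd: 'm)

context cstar_2category
begin

definition cell :: "('m, 'c) cell \<Rightarrow> bool" where
  "cell t \<longleftrightarrow> dm t \<in> objs B \<and> cd t \<in> objs B \<and> src B (cd t) = src B (dm t) \<and>
     tgt B (cd t) = tgt B (dm t) \<and> val t \<in> hom B (dm t) (cd t)"

definition vcomp :: "('m, 'c) cell \<Rightarrow> ('m, 'c) cell \<Rightarrow> ('m, 'c) cell" (infixr "\<diamondop>" 70) where
  "t \<diamondop> s = Cell (dm s) (val t \<cdot> val s) (cd t)"

definition hcomp :: "('m, 'c) cell \<Rightarrow> ('m, 'c) cell \<Rightarrow> ('m, 'c) cell" (infixl "\<boxtimes>" 80) where
  "s \<boxtimes> t = Cell (dm s \<otimes> dm t) (hten B (dm s) (cd s) (dm t) (cd t) (val s) (val t)) (cd s \<otimes> cd t)"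

definition I :: "'m \<Rightarrow> ('m, 'c) cell" where
  "I X = Cell X (idn B X) X"

definition dagger :: "('m, 'c) cell \<Rightarrow> ('m, 'c) cell" ("_\<^sup>\<dagger>" [999] 999) where
  "t\<^sup>\<dagger> = Cell (cd t) (dag B (val t)) (dm t)"

definition \<alpha> :: "'m \<Rightarrow> 'm \<Rightarrow> 'm \<Rightarrow> ('m, 'c) cell" where
  "\<alpha> X Y Z = Cell (X \<otimes> Y \<otimes> Z) (assoc B X Y Z) (X \<otimes> (Y \<otimes> Z))"

definition \<l> :: "'m \<Rightarrow> ('m, 'c) cell" where
  "\<l> X = Cell (unit1 B (src B X) \<otimes> X) (lunit B X) X"

definition \<r> :: "'m \<Rightarrow> ('m, 'c) cell" where
  "\<r> X = Cell (X \<otimes> unit1 B (tgt B X)) (runit B X) X"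

lemma cell_boundary [simp]:
  "dm (t \<diamondop> s) = dm s" "cd (t \<diamondop> s) = cd t"
  "dm (s \<boxtimes> t) = dm s \<otimes> dm t" "cd (s \<boxtimes> t) = cd s \<otimes> cd t"
  "dm (I X) = X" "cd (I X) = X" "dm (t\<^sup>\<dagger>) = cd t" "cd (t\<^sup>\<dagger>) = dm t"
  "dm (\<alpha> X Y Z) = X \<otimes> Y \<otimes> Z" "cd (\<alpha> X Y Z) = X \<otimes> (Y \<otimes> Z)"
  "dm (\<l> X) = unit1 B (src B X) \<otimes> X" "cd (\<l> X) = X"
  "dm (\<r> X) = X \<otimes> unit1 B (tgt B X)" "cd (\<r> X) = X"
  by (simp_all add: vcomp_def hcomp_def I_def dagger_def \<alpha>_def \<l>_def \<r>_def)

lemma in_mor1: "X \<in> objs B \<Longrightarrow> X \<in> mor1 B (src B X) (tgt B X)"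
  by (simp add: mor1_def)

lemma cell_objs [simp]:
  assumes "cell t"
  shows "dm t \<in> objs B" "cd t \<in> objs B" "src B (cd t) = src B (dm t)" "tgt B (cd t) = tgt B (dm t)"
  using assms by (auto simp: cell_def)

lemma cell_mor1:
  assumes "cell t"
  shows "dm t \<in> mor1 B (src B (dm t)) (tgt B (dm t))" "cd t \<in> mor1 B (src B (dm t)) (tgt B (dm t))"
    "val t \<in> hom B (dm t) (cd t)"
  using assms by (auto simp: cell_def mor1_def simp del: cell_objs)

lemma ten_objs [simp]:
  assumes "X \<in> objs B" "Y \<in> objs B" "tgt B X = src B Y"
  shows "X \<otimes> Y \<in> objs B" "src B (X \<otimes> Y) = src B X" "tgt B (X \<otimes> Y) = tgt B Y"
proof -
  have "X \<otimes> Y \<in> mor1 B (src B X) (tgt B Y)"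
    by (rule ten_mor[of X "src B X" "src B Y" Y "tgt B Y"]) (simp_all add: mor1_def assms)
  thus "X \<otimes> Y \<in> objs B" "src B (X \<otimes> Y) = src B X" "tgt B (X \<otimes> Y) = tgt B Y"
    by (simp_all add: mor1_def)
qed

lemma unit1_objs [simp]:
  assumes "a \<in> ob B"
  shows "unit1 B a \<in> objs B" "src B (unit1 B a) = a" "tgt B (unit1 B a) = a"
  using unit1_mor[OF assms] by (auto simp: mor1_def)

lemma src_tgt_ob [simp]: "X \<in> objs B \<Longrightarrow> src B X \<in> ob B" "X \<in> objs B \<Longrightarrow> tgt B X \<in> ob B"
  by (simp_all add: src_ob tgt_ob)

lemma homcat_dagger_category: "X \<in> objs B \<Longrightarrow> dagger_category (homcat B (src B X) (tgt B X))"
  using homcat_cstar[of "src B X" "tgt B X"] by (simp add: cstar_category_def)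

lemma cell_vcomp [simp]: "\<lbrakk>cell t; cell s; cd s = dm t\<rbrakk> \<Longrightarrow> cell (t \<diamondop> s)"
  using dagger_category.cmp_hom[OF homcat_dagger_category[of "dm s"], of "dm s" "cd s" "cd t" "val s" "val t"]
  by (auto simp: cell_def vcomp_def mor1_def simp del: cell_objs)

lemma cell_hcomp [simp]: "\<lbrakk>cell s; cell t; tgt B (dm s) = src B (dm t)\<rbrakk> \<Longrightarrow> cell (s \<boxtimes> t)"
  using hten_hom[of "dm s" "src B (dm s)" "src B (dm t)" "cd s" "dm t" "tgt B (dm t)" "cd t" "val s" "val t"]
  by (auto simp: cell_def hcomp_def mor1_def simp del: cell_objs)

lemma cell_I [simp]: "X \<in> objs B \<Longrightarrow> cell (I X)"
  using dagger_category.idn_hom[OF homcat_dagger_category[of X], of X] by (auto simp: cell_def I_def mor1_def simp del: cell_objs)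

lemma cell_dagger [simp]: "cell t \<Longrightarrow> cell (t\<^sup>\<dagger>)"
  using dagger_category.dag_hom[OF homcat_dagger_category[of "dm t"], of "dm t" "cd t" "val t"]
  by (auto simp: cell_def dagger_def mor1_def simp del: cell_objs)

lemma cell_assoc [simp]:
  "\<lbrakk>X \<in> objs B; Y \<in> objs B; Z \<in> objs B; tgt B X = src B Y; tgt B Y = src B Z\<rbrakk> \<Longrightarrow> cell (\<alpha> X Y Z)"
  using assoc_unitary[of X "src B X" "src B Y" Y "src B Z" Z "tgt B Z"]
  by (auto simp: cell_def \<alpha>_def mor1_def unitary_def simp del: cell_objs)

lemma cell_unitor [simp]: "X \<in> objs B \<Longrightarrow> cell (\<l> X)" "X \<in> objs B \<Longrightarrow> cell (\<r> X)"
  using lunit_unitary[OF in_mor1, of X] runit_unitary[OF in_mor1, of X]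
  by (auto simp: cell_def \<l>_def \<r>_def unitary_def simp del: cell_objs)

lemma vcomp_assoc [simp]:
  "\<lbrakk>cell h; cell g; cell f; cd f = dm g; cd g = dm h\<rbrakk> \<Longrightarrow> (h \<diamondop> g) \<diamondop> f = h \<diamondop> g \<diamondop> f"
  using dagger_category.cmp_assoc[OF homcat_dagger_category[of "dm f"],
      of "dm f" "cd f" "cd g" "cd h" "val f" "val g" "val h"] cell_mor1[of f]
  by (auto simp: cell_def vcomp_def mor1_def simp del: cell_objs)

lemma vcomp_I [simp]: "\<lbrakk>cell f; dm f = X\<rbrakk> \<Longrightarrow> f \<diamondop> I X = f" "\<lbrakk>cell f; cd f = X\<rbrakk> \<Longrightarrow> I X \<diamondop> f = f"
  using dagger_category.cmp_idn[OF homcat_dagger_category[of "dm f"], of "dm f" "cd f" "val f"]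
    dagger_category.idn_cmp[OF homcat_dagger_category[of "dm f"], of "dm f" "cd f" "val f"] cell_mor1[of f]
  by (auto simp: cell_def vcomp_def mor1_def I_def simp del: cell_objs)

lemma dagger_dagger [simp]: "cell f \<Longrightarrow> f\<^sup>\<dagger>\<^sup>\<dagger> = f"
  using dagger_category.dag_dag[OF homcat_dagger_category[of "dm f"], of "dm f" "cd f" "val f"] cell_mor1[of f]
  by (auto simp: dagger_def)

lemma dagger_vcomp [simp]: "\<lbrakk>cell g; cell f; cd f = dm g\<rbrakk> \<Longrightarrow> (g \<diamondop> f)\<^sup>\<dagger> = f\<^sup>\<dagger> \<diamondop> g\<^sup>\<dagger>"
  using dagger_category.dag_cmp[OF homcat_dagger_category[of "dm f"],
      of "dm f" "cd f" "cd g" "val f" "val g"] cell_mor1[of f]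
  by (auto simp: cell_def vcomp_def mor1_def dagger_def simp del: cell_objs)

lemma dagger_I [simp]: "X \<in> objs B \<Longrightarrow> (I X)\<^sup>\<dagger> = I X"
proof -
  assume X: "X \<in> objs B"
  have "(I X)\<^sup>\<dagger> = (I X)\<^sup>\<dagger> \<diamondop> (I X)\<^sup>\<dagger>\<^sup>\<dagger>" using X by simp
  also have "\<dots> = ((I X)\<^sup>\<dagger> \<diamondop> I X)\<^sup>\<dagger>" using X by (subst dagger_vcomp) auto
  also have "\<dots> = I X" using X by simp
  finally show ?thesis .
qed

lemma hcomp_I [simp]:
  "\<lbrakk>X \<in> objs B; Y \<in> objs B; tgt B X = src B Y\<rbrakk> \<Longrightarrow> I X \<boxtimes> I Y = I (X \<otimes> Y)"
  using hten_idn[of X "src B X" "src B Y" Y "tgt B Y"] by (auto simp: I_def hcomp_def mor1_def)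

lemma interchange:
  "\<lbrakk>cell s'; cell s; cell t'; cell t; cd s = dm s'; cd t = dm t'; tgt B (dm s) = src B (dm t)\<rbrakk>
   \<Longrightarrow> (s' \<diamondop> s) \<boxtimes> (t' \<diamondop> t) = (s' \<boxtimes> t') \<diamondop> (s \<boxtimes> t)"
  using hten_cmp[of "dm s" "src B (dm s)" "src B (dm t)" "cd s" "cd s'" "dm t" "tgt B (dm t)" "cd t" "cd t'"
      "val s" "val s'" "val t" "val t'"]
  by (auto simp: hcomp_def vcomp_def mor1_def cell_def simp del: cell_objs)

lemma dagger_hcomp [simp]:
  "\<lbrakk>cell s; cell t; tgt B (dm s) = src B (dm t)\<rbrakk> \<Longrightarrow> (s \<boxtimes> t)\<^sup>\<dagger> = s\<^sup>\<dagger> \<boxtimes> t\<^sup>\<dagger>"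
  using hten_dag[of "dm s" "src B (dm s)" "src B (dm t)" "cd s" "dm t" "tgt B (dm t)" "cd t" "val s" "val t"]
  by (auto simp: hcomp_def dagger_def mor1_def cell_def simp del: cell_objs)

lemma assoc_nat:
  "\<lbrakk>cell f; cell g; cell h; tgt B (dm f) = src B (dm g); tgt B (dm g) = src B (dm h)\<rbrakk>
   \<Longrightarrow> \<alpha> (cd f) (cd g) (cd h) \<diamondop> (f \<boxtimes> g \<boxtimes> h) = (f \<boxtimes> (g \<boxtimes> h)) \<diamondop> \<alpha> (dm f) (dm g) (dm h)"
  using assoc_natural[of "dm f" "src B (dm f)" "src B (dm g)" "cd f" "dm g" "src B (dm h)" "cd g"
      "dm h" "tgt B (dm h)" "cd h" "val f" "val g" "val h"]
  by (auto simp: hcomp_def vcomp_def \<alpha>_def mor1_def cell_def simp del: cell_objs)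

text \<open>
  Here and below a unit 1-morphism is a variable \<open>E\<close> with a defining premise, so that the rules also
  match terms in which the unit has been given a name.
\<close>

lemma lunit_nat: "\<lbrakk>cell f; E = unit1 B (src B (dm f))\<rbrakk> \<Longrightarrow> \<l> (cd f) \<diamondop> (I E \<boxtimes> f) = f \<diamondop> \<l> (dm f)"
  using lunit_natural[of "dm f" "src B (dm f)" "tgt B (dm f)" "cd f" "val f"]
  by (auto simp: hcomp_def vcomp_def \<l>_def I_def lwh_def mor1_def cell_def simp del: cell_objs)

lemma runit_nat: "\<lbrakk>cell f; E = unit1 B (tgt B (dm f))\<rbrakk> \<Longrightarrow> \<r> (cd f) \<diamondop> (f \<boxtimes> I E) = f \<diamondop> \<r> (dm f)"
  using runit_natural[of "dm f" "src B (dm f)" "tgt B (dm f)" "cd f" "val f"]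
  by (auto simp: hcomp_def vcomp_def \<r>_def I_def rwh_def mor1_def cell_def simp del: cell_objs)

lemma pentagon_cells:
  "\<lbrakk>W \<in> objs B; X \<in> objs B; Y \<in> objs B; Z \<in> objs B; tgt B W = src B X; tgt B X = src B Y; tgt B Y = src B Z\<rbrakk>
   \<Longrightarrow> (I W \<boxtimes> \<alpha> X Y Z) \<diamondop> \<alpha> W (X \<otimes> Y) Z \<diamondop> (\<alpha> W X Y \<boxtimes> I Z) = \<alpha> W X (Y \<otimes> Z) \<diamondop> \<alpha> (W \<otimes> X) Y Z"
  using pentagon[of W "src B W" "src B X" X "src B Y" Y "src B Z" Z "tgt B Z"]
  by (auto simp: hcomp_def vcomp_def \<alpha>_def I_def rwh_def lwh_def mor1_def cell_def simp del: cell_objs)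

lemma triangle_cells:
  "\<lbrakk>X \<in> objs B; Y \<in> objs B; tgt B X = src B Y; E = unit1 B (src B Y)\<rbrakk>
   \<Longrightarrow> (I X \<boxtimes> \<l> Y) \<diamondop> \<alpha> X E Y = \<r> X \<boxtimes> I Y"
  using triangle[of X "src B X" "src B Y" Y "tgt B Y"]
  by (auto simp: hcomp_def vcomp_def \<alpha>_def \<l>_def \<r>_def I_def rwh_def lwh_def mor1_def cell_def simp del: cell_objs)

definition unitary_cell :: "('m, 'c) cell \<Rightarrow> bool" where
  "unitary_cell u \<longleftrightarrow> cell u \<and> u\<^sup>\<dagger> \<diamondop> u = I (dm u) \<and> u \<diamondop> u\<^sup>\<dagger> = I (cd u)"

lemma unitary_cell_iff:
  "unitary_cell u \<longleftrightarrow> cell u \<and> unitary B (dm u) (cd u) (val u)"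
  by (auto simp: unitary_cell_def unitary_def cell_def dagger_def vcomp_def I_def simp del: cell_objs)

lemma unitary_is_cell: "unitary_cell u \<Longrightarrow> cell u"
  by (simp add: unitary_cell_def)

lemma unitary_cancel [simp]:
  assumes "unitary_cell u"
  shows "u\<^sup>\<dagger> \<diamondop> u = I (dm u)" "u \<diamondop> u\<^sup>\<dagger> = I (cd u)"
    "\<lbrakk>cell f; cd f = dm u\<rbrakk> \<Longrightarrow> u\<^sup>\<dagger> \<diamondop> u \<diamondop> f = f"
    "\<lbrakk>cell f; cd f = cd u\<rbrakk> \<Longrightarrow> u \<diamondop> u\<^sup>\<dagger> \<diamondop> f = f"
proof -
  show 1: "u\<^sup>\<dagger> \<diamondop> u = I (dm u)" and 2: "u \<diamondop> u\<^sup>\<dagger> = I (cd u)"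
    using assms by (simp_all add: unitary_cell_def)
  have u: "cell u" using assms by (simp add: unitary_cell_def)
  show "u\<^sup>\<dagger> \<diamondop> u \<diamondop> f = f" if "cell f" "cd f = dm u"
    by (rule trans[OF vcomp_assoc[symmetric]]) (simp_all only: 1 that u cell_dagger cell_boundary vcomp_I)
  show "u \<diamondop> u\<^sup>\<dagger> \<diamondop> f = f" if "cell f" "cd f = cd u"
    by (rule trans[OF vcomp_assoc[symmetric]]) (simp_all only: 2 that u cell_dagger cell_boundary vcomp_I)
qed

lemma unitary_dagger [simp]: "unitary_cell u \<Longrightarrow> unitary_cell (u\<^sup>\<dagger>)"
  by (simp add: unitary_cell_def del: unitary_cancel)

lemma unitary_I [simp]: "X \<in> objs B \<Longrightarrow> unitary_cell (I X)"
  by (simp add: unitary_cell_def del: unitary_cancel)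

lemma unitary_vcomp [simp]:
  "\<lbrakk>unitary_cell u; unitary_cell v; cd v = dm u\<rbrakk> \<Longrightarrow> unitary_cell (u \<diamondop> v)"
  by (subst unitary_cell_def) (simp add: unitary_is_cell)

lemma unitary_hcomp [simp]:
  "\<lbrakk>unitary_cell u; unitary_cell v; tgt B (dm u) = src B (dm v)\<rbrakk> \<Longrightarrow> unitary_cell (u \<boxtimes> v)"
  by (subst unitary_cell_def) (simp add: interchange[symmetric] unitary_is_cell)

lemma unitary_structure [simp]:
  "\<lbrakk>X \<in> objs B; Y \<in> objs B; Z \<in> objs B; tgt B X = src B Y; tgt B Y = src B Z\<rbrakk> \<Longrightarrow> unitary_cell (\<alpha> X Y Z)"
  "X \<in> objs B \<Longrightarrow> unitary_cell (\<l> X)" "X \<in> objs B \<Longrightarrow> unitary_cell (\<r> X)"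
  using assoc_unitary[of X "src B X" "src B Y" Y "src B Z" Z "tgt B Z"]
    lunit_unitary[OF in_mor1, of X] runit_unitary[OF in_mor1, of X]
  by (auto simp: unitary_cell_iff) (auto simp: \<alpha>_def \<l>_def \<r>_def mor1_def)

lemma unitary_right_cancel:
  assumes "unitary_cell u" "cell s" "cell t" "dm s = cd u" "dm t = cd u" "s \<diamondop> u = t \<diamondop> u"
  shows "s = t"
proof -
  note unitary_is_cell[OF assms(1), simp]
  have "(s \<diamondop> u) \<diamondop> u\<^sup>\<dagger> = (t \<diamondop> u) \<diamondop> u\<^sup>\<dagger>" using assms(6) by simp
  thus ?thesis using assms(1-5) by simp
qed

lemma unitary_left_cancel:
  assumes "unitary_cell u" "cell s" "cell t" "cd s = dm u" "cd t = dm u" "u \<diamondop> s = u \<diamondop> t"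
  shows "s = t"
proof -
  note unitary_is_cell[OF assms(1), simp]
  have "u\<^sup>\<dagger> \<diamondop> u \<diamondop> s = u\<^sup>\<dagger> \<diamondop> u \<diamondop> t" using assms(6) by simp
  thus ?thesis using assms(1-5) by simp
qed

text \<open>
  Composites are kept associated to the right.  This rule applies an equation for a composite of two
  at the head of a longer composite.
\<close>

lemma vcomp_head:
  assumes "g \<diamondop> f = k" "cell g" "cell f" "cell w" "cd f = dm g" "cd w = dm f"
  shows "g \<diamondop> f \<diamondop> w = k \<diamondop> w"
  using vcomp_assoc[of g f w] assms by (simp del: vcomp_assoc)

lemma unit_whisker_faithful:
  assumes "cell s" "cell t" "dm s = dm t" "cd s = cd t"
  shows "E = unit1 B (src B (dm s)) \<Longrightarrow> I E \<boxtimes> s = I E \<boxtimes> t \<Longrightarrow> s = t"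
    and "E = unit1 B (tgt B (dm s)) \<Longrightarrow> s \<boxtimes> I E = t \<boxtimes> I E \<Longrightarrow> s = t"
proof -
  show "s = t" if E: "E = unit1 B (src B (dm s))" and eq: "I E \<boxtimes> s = I E \<boxtimes> t"
  proof (rule unitary_right_cancel[of "\<l> (dm s)"])
    show "s \<diamondop> \<l> (dm s) = t \<diamondop> \<l> (dm s)"
      using lunit_nat[OF assms(1) E] lunit_nat[OF assms(2), of E] assms(3,4) E eq by metis
  qed (use assms in simp_all)
  show "s = t" if E: "E = unit1 B (tgt B (dm s))" and eq: "s \<boxtimes> I E = t \<boxtimes> I E"
  proof (rule unitary_right_cancel[of "\<r> (dm s)"])
    show "s \<diamondop> \<r> (dm s) = t \<diamondop> \<r> (dm s)"
      using runit_nat[OF assms(1) E] runit_nat[OF assms(2), of E] assms(3,4) E eq by metis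
  qed (use assms in simp_all)
qed

lemma whisker_vcomp:
  assumes "cell t" "cell s" "cd s = dm t"
  shows "\<lbrakk>X \<in> objs B; tgt B X = src B (dm s)\<rbrakk> \<Longrightarrow> I X \<boxtimes> (t \<diamondop> s) = (I X \<boxtimes> t) \<diamondop> (I X \<boxtimes> s)"
    and "\<lbrakk>X \<in> objs B; src B X = tgt B (dm s)\<rbrakk> \<Longrightarrow> (t \<diamondop> s) \<boxtimes> I X = (t \<boxtimes> I X) \<diamondop> (s \<boxtimes> I X)"
  using interchange[of "I X" "I X" t s] interchange[of t s "I X" "I X"] assms by auto

section \<open>Coherence of the unitors\<close>

text \<open>
  Kelly's derivation of the remaining unit coherences.  Tensoring with a unit is faithful, so it
  suffices to compare both sides after doing so; there the pentagon with a unit in the second place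
  reduces the claim to triangles.
\<close>

lemma lunit_ten:
  assumes X: "X \<in> objs B" and Y: "Y \<in> objs B" and XY: "tgt B X = src B Y" and E_eq: "E = unit1 B (src B X)"
  shows "\<l> (X \<otimes> Y) \<diamondop> \<alpha> E X Y = \<l> X \<boxtimes> I Y"
proof -
  note [simp] = X Y XY[symmetric] E_eq[symmetric]
  have E [simp]: "E \<in> objs B" "src B E = src B X" "tgt B E = src B X"
    using unit1_objs[of "src B X"] by (auto simp del: unit1_objs)
  define P where "P = \<alpha> E (E \<otimes> X) Y \<diamondop> (\<alpha> E E X \<boxtimes> I Y)"
  have P [simp]: "unitary_cell P" "cd P = E \<otimes> (E \<otimes> X \<otimes> Y)" by (auto simp: P_def)
  have "(I E \<boxtimes> (\<l> (X \<otimes> Y) \<diamondop> \<alpha> E X Y)) \<diamondop> P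
      = (I E \<boxtimes> \<l> (X \<otimes> Y)) \<diamondop> (I E \<boxtimes> \<alpha> E X Y) \<diamondop> \<alpha> E (E \<otimes> X) Y \<diamondop> (\<alpha> E E X \<boxtimes> I Y)"
    by (simp add: P_def whisker_vcomp)
  also have "\<dots> = ((I E \<boxtimes> \<l> (X \<otimes> Y)) \<diamondop> \<alpha> E E (X \<otimes> Y)) \<diamondop> \<alpha> (E \<otimes> E) X Y"
    by (simp add: pentagon_cells)
  also have "\<dots> = (\<r> E \<boxtimes> (I X \<boxtimes> I Y)) \<diamondop> \<alpha> (E \<otimes> E) X Y"
    by (simp add: triangle_cells vcomp_head[OF triangle_cells])
  also have "\<dots> = \<alpha> E X Y \<diamondop> (\<r> E \<boxtimes> I X \<boxtimes> I Y)"
    using assoc_nat[of "\<r> E" "I X" "I Y"] by simp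
  also have "\<dots> = \<alpha> E X Y \<diamondop> (((I E \<boxtimes> \<l> X) \<diamondop> \<alpha> E E X) \<boxtimes> I Y)"
    by (simp add: triangle_cells)
  also have "\<dots> = (\<alpha> E X Y \<diamondop> (I E \<boxtimes> \<l> X \<boxtimes> I Y)) \<diamondop> (\<alpha> E E X \<boxtimes> I Y)"
    by (simp add: whisker_vcomp)
  also have "\<dots> = (I E \<boxtimes> (\<l> X \<boxtimes> I Y)) \<diamondop> P"
    using assoc_nat[of "I E" "\<l> X" "I Y"] by (simp add: P_def)
  finally have "I E \<boxtimes> (\<l> (X \<otimes> Y) \<diamondop> \<alpha> E X Y) = I E \<boxtimes> (\<l> X \<boxtimes> I Y)"
    by (rule unitary_right_cancel[rotated -1]) auto
  thus "\<l> (X \<otimes> Y) \<diamondop> \<alpha> E X Y = \<l> X \<boxtimes> I Y"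
    by (rule unit_whisker_faithful(1)[rotated -1]) auto
qed

text \<open>
  Mirror image of \<open>lunit_ten\<close>: the pentagon with a unit in the third place, compared after tensoring
  with a unit on the right.
\<close>

lemma runit_ten:
  assumes X: "X \<in> objs B" and Y: "Y \<in> objs B" and XY: "tgt B X = src B Y" and E_eq: "E = unit1 B (tgt B Y)"
  shows "(I X \<boxtimes> \<r> Y) \<diamondop> \<alpha> X Y E = \<r> (X \<otimes> Y)"
proof -
  note [simp] = X Y XY E_eq[symmetric]
  have E [simp]: "E \<in> objs B" "src B E = tgt B Y" "tgt B E = tgt B Y"
    using unit1_objs[of "tgt B Y"] by (auto simp del: unit1_objs)
  have "\<alpha> X Y E \<diamondop> (((I X \<boxtimes> \<r> Y) \<diamondop> \<alpha> X Y E) \<boxtimes> I E)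
      = (\<alpha> X Y E \<diamondop> (I X \<boxtimes> \<r> Y \<boxtimes> I E)) \<diamondop> (\<alpha> X Y E \<boxtimes> I E)"
    by (simp add: whisker_vcomp)
  also have "\<dots> = (I X \<boxtimes> (\<r> Y \<boxtimes> I E)) \<diamondop> \<alpha> X (Y \<otimes> E) E \<diamondop> (\<alpha> X Y E \<boxtimes> I E)"
    using assoc_nat[of "I X" "\<r> Y" "I E"] by simp
  also have "\<dots> = (I X \<boxtimes> (I Y \<boxtimes> \<l> E)) \<diamondop> (I X \<boxtimes> \<alpha> Y E E) \<diamondop> \<alpha> X (Y \<otimes> E) E \<diamondop> (\<alpha> X Y E \<boxtimes> I E)"
    by (simp add: triangle_cells[of Y E E, symmetric] whisker_vcomp)
  also have "\<dots> = ((I X \<boxtimes> (I Y \<boxtimes> \<l> E)) \<diamondop> \<alpha> X Y (E \<otimes> E)) \<diamondop> \<alpha> (X \<otimes> Y) E E"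
    by (simp add: pentagon_cells)
  also have "\<dots> = \<alpha> X Y E \<diamondop> ((I (X \<otimes> Y) \<boxtimes> \<l> E) \<diamondop> \<alpha> (X \<otimes> Y) E E)"
    using vcomp_head[OF assoc_nat[of "I X" "I Y" "\<l> E", symmetric], of "\<alpha> (X \<otimes> Y) E E"] by simp
  also have "\<dots> = \<alpha> X Y E \<diamondop> (\<r> (X \<otimes> Y) \<boxtimes> I E)"
    by (simp add: triangle_cells)
  finally have "((I X \<boxtimes> \<r> Y) \<diamondop> \<alpha> X Y E) \<boxtimes> I E = \<r> (X \<otimes> Y) \<boxtimes> I E"
    by (rule unitary_left_cancel[rotated -1]) auto
  thus "(I X \<boxtimes> \<r> Y) \<diamondop> \<alpha> X Y E = \<r> (X \<otimes> Y)"
    by (rule unit_whisker_faithful(2)[rotated -1]) auto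
qed

text \<open>
  Naturality of \<open>\<l>\<close> along itself gives \<open>1 \<otimes> \<l> = \<l>\<close> on \<open>1 \<otimes> (1 \<otimes> 1)\<close>; then \<open>lunit_ten\<close> and the
  triangle equate \<open>\<l> \<otimes> 1\<close> with \<open>\<r> \<otimes> 1\<close>.
\<close>

lemma lunit_unit1:
  assumes a [simp]: "a \<in> ob B"
  shows "\<l> (unit1 B a) = \<r> (unit1 B a)"
proof -
  define E where "E = unit1 B a"
  note E_def [symmetric, simp]
  have E [simp]: "E \<in> objs B" "src B E = a" "tgt B E = a" using a unit1_objs[of a] by (auto simp del: unit1_objs)
  have dms [simp]: "dm (\<l> E) = E \<otimes> E" "dm (\<r> E) = E \<otimes> E" "dm (\<l> (E \<otimes> E)) = E \<otimes> (E \<otimes> E)"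
    by auto
  have "\<l> E \<diamondop> (I E \<boxtimes> \<l> E) = \<l> E \<diamondop> \<l> (E \<otimes> E)"
    using lunit_nat[of "\<l> E" E] by simp
  hence "I E \<boxtimes> \<l> E = \<l> (E \<otimes> E)"
    by (rule unitary_left_cancel[rotated -1]) auto
  hence "\<l> E \<boxtimes> I E = \<r> E \<boxtimes> I E"
    using lunit_ten[of E E E] triangle_cells[of E E E] by simp
  thus ?thesis unfolding E_def[symmetric]
    by (rule unit_whisker_faithful(2)[rotated -1]) auto
qed

section \<open>Adjoint 1-morphisms\<close>

text \<open>
  The zig-zag equations, with the unitors moved to the other side.
\<close>

definition adjunction :: "'m \<Rightarrow> 'm \<Rightarrow> ('m, 'c) cell \<Rightarrow> ('m, 'c) cell \<Rightarrow> bool" where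
  "adjunction X X' e d \<longleftrightarrow> X \<in> objs B \<and> X' \<in> objs B \<and> src B X' = tgt B X \<and> tgt B X' = src B X \<and>
     cell e \<and> dm e = X' \<otimes> X \<and> cd e = unit1 B (tgt B X) \<and>
     cell d \<and> dm d = unit1 B (src B X) \<and> cd d = X \<otimes> X' \<and>
     \<r> X \<diamondop> (I X \<boxtimes> e) \<diamondop> \<alpha> X X' X \<diamondop> (d \<boxtimes> I X) = \<l> X \<and>
     \<l> X' \<diamondop> (e \<boxtimes> I X') \<diamondop> (\<alpha> X' X X')\<^sup>\<dagger> \<diamondop> (I X' \<boxtimes> d) = \<r> X'"

lemma is_adjoint_adjunction:
  assumes "is_adjoint B a b X X' e d"
  shows "adjunction X X' (Cell (X' \<otimes> X) e (unit1 B b)) (Cell (unit1 B a) d (X \<otimes> X'))"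
proof -
  have X [simp]: "X \<in> objs B" "src B X = a" "tgt B X = b" "X' \<in> objs B" "src B X' = b" "tgt B X' = a"
    using assms by (auto simp: is_adjoint_def mor1_def)
  have [simp]: "a \<in> ob B" "b \<in> ob B" using src_ob[of X] tgt_ob[of X] by simp_all
  define ec dc where "ec = Cell (X' \<otimes> X) e (unit1 B b)" and "dc = Cell (unit1 B a) d (X \<otimes> X')"
  have ec [simp]: "cell ec" "dm ec = X' \<otimes> X" "cd ec = unit1 B b"
    and dc [simp]: "cell dc" "dm dc = unit1 B a" "cd dc = X \<otimes> X'"
    using assms by (auto simp: ec_def dc_def cell_def is_adjoint_def)
  have "\<r> X \<diamondop> (I X \<boxtimes> ec) \<diamondop> \<alpha> X X' X \<diamondop> (dc \<boxtimes> I X) \<diamondop> (\<l> X)\<^sup>\<dagger> = I X"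
    using assms by (simp add: is_adjoint_def \<r>_def \<l>_def \<alpha>_def hcomp_def vcomp_def I_def dagger_def
        ec_def dc_def lwh_def rwh_def)
  hence "(\<r> X \<diamondop> (I X \<boxtimes> ec) \<diamondop> \<alpha> X X' X \<diamondop> (dc \<boxtimes> I X) \<diamondop> (\<l> X)\<^sup>\<dagger>) \<diamondop> \<l> X = \<l> X"
    by simp
  moreover have "\<l> X' \<diamondop> (ec \<boxtimes> I X') \<diamondop> (\<alpha> X' X X')\<^sup>\<dagger> \<diamondop> (I X' \<boxtimes> dc) \<diamondop> (\<r> X')\<^sup>\<dagger> = I X'"
    using assms by (simp add: is_adjoint_def \<r>_def \<l>_def \<alpha>_def hcomp_def vcomp_def I_def dagger_def
        ec_def dc_def lwh_def rwh_def)
  hence "(\<l> X' \<diamondop> (ec \<boxtimes> I X') \<diamondop> (\<alpha> X' X X')\<^sup>\<dagger> \<diamondop> (I X' \<boxtimes> dc) \<diamondop> (\<r> X')\<^sup>\<dagger>) \<diamondop> \<r> X' = \<r> X'"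
    by simp
  ultimately have "adjunction X X' ec dc"
    by (simp add: adjunction_def)
  thus ?thesis by (simp add: ec_def dc_def)
qed

lemma assoc_nat_dagger:
  assumes "cell f" "cell g" "cell h" "tgt B (dm f) = src B (dm g)" "tgt B (dm g) = src B (dm h)"
  shows "(\<alpha> (cd f) (cd g) (cd h))\<^sup>\<dagger> \<diamondop> (f \<boxtimes> (g \<boxtimes> h)) = (f \<boxtimes> g \<boxtimes> h) \<diamondop> (\<alpha> (dm f) (dm g) (dm h))\<^sup>\<dagger>"
  using arg_cong[OF assoc_nat[of "f\<^sup>\<dagger>" "g\<^sup>\<dagger>" "h\<^sup>\<dagger>"], of dagger] assms by simp

text \<open>
  A 2-morphism into \<open>X \<otimes> X'\<close> can be recovered from its transpose, so transposition is injective.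
  Sliding \<open>f\<close> to the right past \<open>d\<close> leaves \<open>X\<close> tensored with the second zig-zag composite.
\<close>

lemma adjunction_transpose:
  assumes adj: "adjunction X X' e d" and f [simp]: "cell f" and cdf [simp]: "cd f = X \<otimes> X'"
  shows "f = (\<r> X \<boxtimes> I X') \<diamondop> (((I X \<boxtimes> e) \<diamondop> \<alpha> X X' X \<diamondop> (f \<boxtimes> I X)) \<boxtimes> I X') \<diamondop>
     (\<alpha> (dm f) X X')\<^sup>\<dagger> \<diamondop> (I (dm f) \<boxtimes> d) \<diamondop> (\<r> (dm f))\<^sup>\<dagger>"
proof -
  define W where "W = dm f"
  define E E' where "E = unit1 B (src B X)" and "E' = unit1 B (tgt B X)"
  note W_def [symmetric, simp] E_def [symmetric, simp] E'_def [symmetric, simp]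
  have X [simp]: "X \<in> objs B" "X' \<in> objs B" "src B X' = tgt B X" "tgt B X' = src B X"
    and e [simp]: "cell e" "dm e = X' \<otimes> X" "cd e = E'"
    and d [simp]: "cell d" "dm d = E" "cd d = X \<otimes> X'"
    and zig: "\<l> X' \<diamondop> (e \<boxtimes> I X') \<diamondop> (\<alpha> X' X X')\<^sup>\<dagger> \<diamondop> (I X' \<boxtimes> d) = \<r> X'"
    using adj by (simp_all add: adjunction_def)
  have E [simp]: "E \<in> objs B" "src B E = src B X" "tgt B E = src B X"
      "E' \<in> objs B" "src B E' = tgt B X" "tgt B E' = tgt B X"
    using unit1_objs[of "src B X"] unit1_objs[of "tgt B X"] by (simp_all del: unit1_objs)
  have W [simp]: "W \<in> objs B" "src B W = src B X" "tgt B W = src B X"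
    using cell_objs[OF f] by (simp_all del: cell_objs)
  have s1: "(f \<boxtimes> I X \<boxtimes> I X') \<diamondop> (\<alpha> W X X')\<^sup>\<dagger> = (\<alpha> (X \<otimes> X') X X')\<^sup>\<dagger> \<diamondop> (f \<boxtimes> I (X \<otimes> X'))"
    using assoc_nat_dagger[of f "I X" "I X'"] by simp
  have s2: "(f \<boxtimes> I (X \<otimes> X')) \<diamondop> (I W \<boxtimes> d) = (I (X \<otimes> X') \<boxtimes> d) \<diamondop> (f \<boxtimes> I E)"
    by (simp add: interchange[symmetric])
  have s3: "(f \<boxtimes> I E) \<diamondop> (\<r> W)\<^sup>\<dagger> = (\<r> (X \<otimes> X'))\<^sup>\<dagger> \<diamondop> f"
    using arg_cong[OF runit_nat[of "f\<^sup>\<dagger>" E], of dagger] by simp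
  \<comment> \<open>the pentagon for \<open>X\<close>, \<open>X'\<close>, \<open>X\<close>, \<open>X'\<close>, with two associators moved to the other side\<close>
  have s4: "(\<alpha> X X' X \<boxtimes> I X') \<diamondop> (\<alpha> (X \<otimes> X') X X')\<^sup>\<dagger>
      = (\<alpha> X (X' \<otimes> X) X')\<^sup>\<dagger> \<diamondop> (I X \<boxtimes> (\<alpha> X' X X')\<^sup>\<dagger>) \<diamondop> \<alpha> X X' (X \<otimes> X')"
  proof (rule unitary_right_cancel[of "\<alpha> (X \<otimes> X') X X'"])
    have "(I X \<boxtimes> (\<alpha> X' X X')\<^sup>\<dagger>) \<diamondop> \<alpha> X X' (X \<otimes> X') \<diamondop> \<alpha> (X \<otimes> X') X X'
       = (I X \<boxtimes> (\<alpha> X' X X')\<^sup>\<dagger>) \<diamondop> (I X \<boxtimes> \<alpha> X' X X') \<diamondop> \<alpha> X (X' \<otimes> X) X' \<diamondop> (\<alpha> X X' X \<boxtimes> I X')"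
      by (simp add: pentagon_cells)
    also have "\<dots> = \<alpha> X (X' \<otimes> X) X' \<diamondop> (\<alpha> X X' X \<boxtimes> I X')"
      using unitary_cancel(3)[of "I X \<boxtimes> \<alpha> X' X X'" "\<alpha> X (X' \<otimes> X) X' \<diamondop> (\<alpha> X X' X \<boxtimes> I X')"] by simp
    finally show "((\<alpha> X X' X \<boxtimes> I X') \<diamondop> (\<alpha> (X \<otimes> X') X X')\<^sup>\<dagger>) \<diamondop> \<alpha> (X \<otimes> X') X X'
      = ((\<alpha> X (X' \<otimes> X) X')\<^sup>\<dagger> \<diamondop> (I X \<boxtimes> (\<alpha> X' X X')\<^sup>\<dagger>) \<diamondop> \<alpha> X X' (X \<otimes> X')) \<diamondop> \<alpha> (X \<otimes> X') X X'"
      by simp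
  qed auto
  have s5: "(I X \<boxtimes> e \<boxtimes> I X') \<diamondop> (\<alpha> X (X' \<otimes> X) X')\<^sup>\<dagger> = (\<alpha> X E' X')\<^sup>\<dagger> \<diamondop> (I X \<boxtimes> (e \<boxtimes> I X'))"
    using assoc_nat_dagger[of "I X" e "I X'"] by simp
  have s6: "(\<r> X \<boxtimes> I X') \<diamondop> (\<alpha> X E' X')\<^sup>\<dagger> = I X \<boxtimes> \<l> X'"
    by (simp add: triangle_cells[of X X' E', symmetric])
  have s7: "\<alpha> X X' (X \<otimes> X') \<diamondop> (I (X \<otimes> X') \<boxtimes> d) = (I X \<boxtimes> (I X' \<boxtimes> d)) \<diamondop> \<alpha> X X' E"
    using assoc_nat[of "I X" "I X'" d] by simp
  have s8: "\<alpha> X X' E \<diamondop> (\<r> (X \<otimes> X'))\<^sup>\<dagger> = I X \<boxtimes> (\<r> X')\<^sup>\<dagger>"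
    by (simp add: runit_ten[of X X' E, symmetric])
  have "(\<r> X \<boxtimes> I X') \<diamondop> (((I X \<boxtimes> e) \<diamondop> \<alpha> X X' X \<diamondop> (f \<boxtimes> I X)) \<boxtimes> I X') \<diamondop>
     (\<alpha> W X X')\<^sup>\<dagger> \<diamondop> (I W \<boxtimes> d) \<diamondop> (\<r> W)\<^sup>\<dagger>
    = (\<r> X \<boxtimes> I X') \<diamondop> (I X \<boxtimes> e \<boxtimes> I X') \<diamondop> (\<alpha> X X' X \<boxtimes> I X') \<diamondop> (\<alpha> (X \<otimes> X') X X')\<^sup>\<dagger> \<diamondop>
     (I (X \<otimes> X') \<boxtimes> d) \<diamondop> (\<r> (X \<otimes> X'))\<^sup>\<dagger> \<diamondop> f"
    by (simp add: whisker_vcomp vcomp_head[OF s1] vcomp_head[OF s2] vcomp_head[OF s3] s3)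
  also have "\<dots> = (I X \<boxtimes> \<l> X') \<diamondop> (I X \<boxtimes> (e \<boxtimes> I X')) \<diamondop> (I X \<boxtimes> (\<alpha> X' X X')\<^sup>\<dagger>) \<diamondop>
      (I X \<boxtimes> (I X' \<boxtimes> d)) \<diamondop> (I X \<boxtimes> (\<r> X')\<^sup>\<dagger>) \<diamondop> f"
    by (simp add: vcomp_head[OF s4] vcomp_head[OF s5] vcomp_head[OF s6] vcomp_head[OF s7] vcomp_head[OF s8])
  also have "\<dots> = (I X \<boxtimes> ((\<l> X' \<diamondop> (e \<boxtimes> I X') \<diamondop> (\<alpha> X' X X')\<^sup>\<dagger> \<diamondop> (I X' \<boxtimes> d)) \<diamondop> (\<r> X')\<^sup>\<dagger>)) \<diamondop> f"
    by (simp add: whisker_vcomp)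
  also have "\<dots> = f"
    unfolding zig by simp
  finally show ?thesis by simp
qed

text \<open>
  Fullness provides \<open>r\<close> whose image under \<open>- \<otimes> X\<close> is, up to unitors, \<open>X \<otimes> e\<close>.  The first zig-zag
  equation and faithfulness give \<open>r d = 1\<close>; \<open>d r\<close> and \<open>1\<close> have the same transpose, so \<open>d r = 1\<close>.  Being an
  isometry, \<open>d\<close> then has \<open>r = d\<^sup>\<dagger>\<close>.
\<close>

lemma coev_unitary:
  assumes adj: "adjunction X X' e d" and iso: "d\<^sup>\<dagger> \<diamondop> d = I E" and E_eq: "E = unit1 B (src B X)"
    and full: "\<And>t. \<lbrakk>cell t; dm t = X \<otimes> X' \<otimes> X; cd t = E \<otimes> X\<rbrakk>
      \<Longrightarrow> \<exists>r. cell r \<and> dm r = X \<otimes> X' \<and> cd r = E \<and> r \<boxtimes> I X = t"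
    and faithful: "\<And>s. \<lbrakk>cell s; dm s = E; cd s = E; s \<boxtimes> I X = I E \<boxtimes> I X\<rbrakk> \<Longrightarrow> s = I E"
  shows "unitary_cell d"
proof -
  define E' where "E' = unit1 B (tgt B X)"
  note E_eq [symmetric, simp] E'_def [symmetric, simp]
  have X [simp]: "X \<in> objs B" "X' \<in> objs B" "src B X' = tgt B X" "tgt B X' = src B X"
    and e [simp]: "cell e" "dm e = X' \<otimes> X" "cd e = E'"
    and d [simp]: "cell d" "dm d = E" "cd d = X \<otimes> X'"
    and zig: "\<r> X \<diamondop> (I X \<boxtimes> e) \<diamondop> \<alpha> X X' X \<diamondop> (d \<boxtimes> I X) = \<l> X"
    using adj by (simp_all add: adjunction_def)
  have E [simp]: "E \<in> objs B" "src B E = src B X" "tgt B E = src B X"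
      "E' \<in> objs B" "src B E' = tgt B X" "tgt B E' = tgt B X"
    using unit1_objs[of "src B X"] unit1_objs[of "tgt B X"] by (simp_all del: unit1_objs)
  have "\<exists>r. cell r \<and> dm r = X \<otimes> X' \<and> cd r = E \<and>
      r \<boxtimes> I X = (\<l> X)\<^sup>\<dagger> \<diamondop> \<r> X \<diamondop> (I X \<boxtimes> e) \<diamondop> \<alpha> X X' X"
    by (rule full) auto
  then obtain r where r [simp]: "cell r" "dm r = X \<otimes> X'" "cd r = E"
    and rX: "r \<boxtimes> I X = (\<l> X)\<^sup>\<dagger> \<diamondop> \<r> X \<diamondop> (I X \<boxtimes> e) \<diamondop> \<alpha> X X' X"
    by blast
  have rd: "r \<diamondop> d = I E"
  proof (rule faithful)
    have "(r \<diamondop> d) \<boxtimes> I X = (r \<boxtimes> I X) \<diamondop> (d \<boxtimes> I X)"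
      by (simp add: whisker_vcomp)
    also have "\<dots> = (\<l> X)\<^sup>\<dagger> \<diamondop> \<l> X"
      by (simp add: rX zig)
    finally show "(r \<diamondop> d) \<boxtimes> I X = I E \<boxtimes> I X" by simp
  qed auto
  have T: "(I X \<boxtimes> e) \<diamondop> \<alpha> X X' X = (\<r> X)\<^sup>\<dagger> \<diamondop> \<l> X \<diamondop> (r \<boxtimes> I X)"
    by (simp add: rX)
  have "r \<diamondop> d \<diamondop> r = I E \<diamondop> r"
    by (rule vcomp_head[OF rd]) auto
  hence rdr: "(r \<boxtimes> I X) \<diamondop> ((d \<diamondop> r) \<boxtimes> I X) = r \<boxtimes> I X"
    by (simp add: interchange[symmetric])
  have "(I X \<boxtimes> e) \<diamondop> \<alpha> X X' X \<diamondop> ((d \<diamondop> r) \<boxtimes> I X) = (\<r> X)\<^sup>\<dagger> \<diamondop> \<l> X \<diamondop> (r \<boxtimes> I X)"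
    using vcomp_head[OF T, of "(d \<diamondop> r) \<boxtimes> I X"] by (simp add: rdr)
  also have "\<dots> = (I X \<boxtimes> e) \<diamondop> \<alpha> X X' X \<diamondop> (I (X \<otimes> X') \<boxtimes> I X)"
    by (simp add: T)
  finally have "d \<diamondop> r = I (X \<otimes> X')"
    using adjunction_transpose[OF adj, of "d \<diamondop> r"] adjunction_transpose[OF adj, of "I (X \<otimes> X')"]
    by simp
  moreover have "d\<^sup>\<dagger> = r"
    using vcomp_head[OF iso, of r] calculation by simp
  ultimately show ?thesis
    using iso by (simp add: unitary_cell_def del: unitary_cancel)
qed

text \<open>
  The first zig-zag equation expresses \<open>X \<otimes> e\<close> as the inverse of a composite of unitaries.
\<close>

lemma ev_unitary:
  assumes adj: "adjunction X X' e d" and d_unitary [simp]: "unitary_cell d"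
    and faithful: "\<And>s. \<lbrakk>cell s; cd s = dm s; tgt B X = src B (dm s); I X \<boxtimes> s = I X \<boxtimes> I (dm s)\<rbrakk> \<Longrightarrow> s = I (dm s)"
  shows "unitary_cell e"
proof -
  define E E' where "E = unit1 B (src B X)" and "E' = unit1 B (tgt B X)"
  note E_def [symmetric, simp] E'_def [symmetric, simp]
  have X [simp]: "X \<in> objs B" "X' \<in> objs B" "src B X' = tgt B X" "tgt B X' = src B X"
    and e [simp]: "cell e" "dm e = X' \<otimes> X" "cd e = E'"
    and d [simp]: "cell d" "dm d = E" "cd d = X \<otimes> X'"
    and zig: "\<r> X \<diamondop> (I X \<boxtimes> e) \<diamondop> \<alpha> X X' X \<diamondop> (d \<boxtimes> I X) = \<l> X"
    using adj by (simp_all add: adjunction_def)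
  have E [simp]: "E \<in> objs B" "src B E = src B X" "tgt B E = src B X"
      "E' \<in> objs B" "src B E' = tgt B X" "tgt B E' = tgt B X"
    using unit1_objs[of "src B X"] unit1_objs[of "tgt B X"] by (simp_all del: unit1_objs)
  define U where "U = (\<r> X)\<^sup>\<dagger> \<diamondop> \<l> X \<diamondop> (\<alpha> X X' X \<diamondop> (d \<boxtimes> I X))\<^sup>\<dagger>"
  have U: "unitary_cell U" unfolding U_def by (intro unitary_vcomp unitary_dagger unitary_hcomp) auto
  have "I X \<boxtimes> e = U"
  proof (rule unitary_right_cancel[of "\<alpha> X X' X \<diamondop> (d \<boxtimes> I X)"])
    have "(\<r> X)\<^sup>\<dagger> \<diamondop> \<r> X \<diamondop> (I X \<boxtimes> e) \<diamondop> \<alpha> X X' X \<diamondop> (d \<boxtimes> I X) = (\<r> X)\<^sup>\<dagger> \<diamondop> \<l> X"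
      by (simp only: zig)
    moreover have "(\<alpha> X X' X \<diamondop> (d \<boxtimes> I X))\<^sup>\<dagger> \<diamondop> (\<alpha> X X' X \<diamondop> (d \<boxtimes> I X)) = I (E \<otimes> X)"
      by (subst unitary_cancel) auto
    ultimately show "(I X \<boxtimes> e) \<diamondop> \<alpha> X X' X \<diamondop> (d \<boxtimes> I X) = U \<diamondop> \<alpha> X X' X \<diamondop> (d \<boxtimes> I X)"
      by (simp add: U_def del: dagger_vcomp)
  qed (auto simp: U_def)
  hence Xe: "unitary_cell (I X \<boxtimes> e)" using U by simp
  have "I X \<boxtimes> (e\<^sup>\<dagger> \<diamondop> e) = I X \<boxtimes> I (X' \<otimes> X)" "I X \<boxtimes> (e \<diamondop> e\<^sup>\<dagger>) = I X \<boxtimes> I E'"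
    using unitary_cancel(1,2)[OF Xe] by (simp_all add: whisker_vcomp)
  hence "e\<^sup>\<dagger> \<diamondop> e = I (X' \<otimes> X)" "e \<diamondop> e\<^sup>\<dagger> = I E'"
    using faithful[of "e\<^sup>\<dagger> \<diamondop> e"] faithful[of "e \<diamondop> e\<^sup>\<dagger>"] by simp_all
  thus ?thesis by (simp add: unitary_cell_def del: unitary_cancel)
qed

text \<open>
  The first zig-zag equation for \<open>1\<^sub>a\<close>, simplified by the unit coherences, says that \<open>d\<close> is inverse to
  the composite of the given unitary \<open>E' \<Rightarrow> E\<close> with \<open>\<l> E'\<close>.
\<close>

lemma unit1_coev_isometric:
  assumes adj: "adjunction E E' e d" and E_eq: "E = unit1 B a" and a [simp]: "a \<in> ob B"
    and u: "unitary_cell (e \<diamondop> (\<r> E')\<^sup>\<dagger>)"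
  shows "d\<^sup>\<dagger> \<diamondop> d = I E"
proof -
  note E_eq [symmetric, simp]
  have E [simp]: "E \<in> objs B" "src B E = a" "tgt B E = a"
    using unit1_objs[of a] by (simp_all del: unit1_objs)
  have E' [simp]: "E' \<in> objs B" "src B E' = a" "tgt B E' = a"
    and e [simp]: "cell e" "dm e = E' \<otimes> E" "cd e = E"
    and d [simp]: "cell d" "dm d = E" "cd d = E \<otimes> E'"
    and zig: "\<r> E \<diamondop> (I E \<boxtimes> e) \<diamondop> \<alpha> E E' E \<diamondop> (d \<boxtimes> I E) = \<l> E"
    using adj by (simp_all add: adjunction_def)
  define u where "u = e \<diamondop> (\<r> E')\<^sup>\<dagger>"
  have u' [simp]: "unitary_cell u" "cell u" "dm u = E'" "cd u = E" using u by (auto simp: u_def)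
  have e_u: "e = u \<diamondop> \<r> E'" by (simp add: u_def)
  have lr: "\<l> E = \<r> E" using lunit_unit1[of a] by simp
  have "(I E \<boxtimes> e) \<diamondop> \<alpha> E E' E \<diamondop> (d \<boxtimes> I E) = (I E \<boxtimes> u) \<diamondop> ((I E \<boxtimes> \<r> E') \<diamondop> \<alpha> E E' E) \<diamondop> (d \<boxtimes> I E)"
    unfolding e_u by (simp add: whisker_vcomp)
  also have "\<dots> = (I E \<boxtimes> u) \<diamondop> \<r> (E \<otimes> E') \<diamondop> (d \<boxtimes> I E)"
    by (simp add: runit_ten vcomp_head[OF runit_ten])
  also have "\<dots> = (I E \<boxtimes> u) \<diamondop> d \<diamondop> \<r> E"
    using runit_nat[of d E] by simp
  finally have "(\<l> E \<diamondop> (I E \<boxtimes> u) \<diamondop> d) \<diamondop> \<r> E = I E \<diamondop> \<r> E"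
    using zig by (simp add: lr)
  hence "\<l> E \<diamondop> (I E \<boxtimes> u) \<diamondop> d = I E"
    by (rule unitary_right_cancel[rotated -1]) auto
  hence ud: "u \<diamondop> \<l> E' \<diamondop> d = I E"
    using vcomp_head[OF lunit_nat[of u E], of d] by simp
  have "d = (u \<diamondop> \<l> E')\<^sup>\<dagger>"
    by (rule unitary_left_cancel[of "u \<diamondop> \<l> E'"]) (auto simp: ud)
  thus ?thesis by simp
qed

text \<open>
  Endomorphisms of a unit slide out of the trace: the loop \<open>X \<otimes> X'\<close> created by \<open>d\<close> can be moved past \<open>f\<close>.
\<close>

lemma left_trace_unit_action:
  assumes adj: "adjunction X X' e d" and E_eq: "E = unit1 B (src B X)"
    and f [simp]: "cell f" "dm f = E" "cd f = E"
  shows "d\<^sup>\<dagger> \<diamondop> ((\<l> X \<diamondop> (f \<boxtimes> I X) \<diamondop> (\<l> X)\<^sup>\<dagger>) \<boxtimes> I X') \<diamondop> d = (d\<^sup>\<dagger> \<diamondop> d) \<diamondop> f"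
proof -
  note E_eq [symmetric, simp]
  have X [simp]: "X \<in> objs B" "X' \<in> objs B" "src B X' = tgt B X" "tgt B X' = src B X"
    and d [simp]: "cell d" "dm d = E" "cd d = X \<otimes> X'"
    using adj by (simp_all add: adjunction_def)
  have E [simp]: "E \<in> objs B" "src B E = src B X" "tgt B E = src B X"
    using unit1_objs[of "src B X"] by (simp_all del: unit1_objs)
  have lr: "\<l> E = \<r> E" using lunit_unit1[of "src B X"] by simp
  have lX: "\<l> X \<boxtimes> I X' = \<l> (X \<otimes> X') \<diamondop> \<alpha> E X X'" by (simp add: lunit_ten)
  have s0: "(\<l> X)\<^sup>\<dagger> \<boxtimes> I X' = (\<alpha> E X X')\<^sup>\<dagger> \<diamondop> (\<l> (X \<otimes> X'))\<^sup>\<dagger>"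
    using arg_cong[OF lX, of dagger] by simp
  have s1: "(f \<boxtimes> I X \<boxtimes> I X') \<diamondop> (\<alpha> E X X')\<^sup>\<dagger> = (\<alpha> E X X')\<^sup>\<dagger> \<diamondop> (f \<boxtimes> I (X \<otimes> X'))"
    using assoc_nat_dagger[of f "I X" "I X'"] by simp
  have s2: "(\<l> (X \<otimes> X'))\<^sup>\<dagger> \<diamondop> d = (I E \<boxtimes> d) \<diamondop> (\<l> E)\<^sup>\<dagger>"
    using arg_cong[OF lunit_nat[of "d\<^sup>\<dagger>" E], of dagger] by simp
  have s3: "(f \<boxtimes> I (X \<otimes> X')) \<diamondop> (I E \<boxtimes> d) = (I E \<boxtimes> d) \<diamondop> (f \<boxtimes> I E)"
    by (simp add: interchange[symmetric])
  have s4: "\<l> (X \<otimes> X') \<diamondop> (I E \<boxtimes> d) = d \<diamondop> \<l> E"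
    using lunit_nat[of d E] by simp
  have s5: "(f \<boxtimes> I E) \<diamondop> (\<l> E)\<^sup>\<dagger> = (\<l> E)\<^sup>\<dagger> \<diamondop> f"
    using arg_cong[OF runit_nat[of "f\<^sup>\<dagger>" E], of dagger] by (simp add: lr)
  have "((\<l> X \<diamondop> (f \<boxtimes> I X) \<diamondop> (\<l> X)\<^sup>\<dagger>) \<boxtimes> I X') \<diamondop> d
     = \<l> (X \<otimes> X') \<diamondop> \<alpha> E X X' \<diamondop> (f \<boxtimes> I X \<boxtimes> I X') \<diamondop> (\<alpha> E X X')\<^sup>\<dagger> \<diamondop> (\<l> (X \<otimes> X'))\<^sup>\<dagger> \<diamondop> d"
    by (simp add: whisker_vcomp lX s0)
  also have "\<dots> = d \<diamondop> f"
    by (simp add: s2 s5 vcomp_head[OF s1] vcomp_head[OF s3] vcomp_head[OF s4])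
  finally show ?thesis by simp
qed

lemma lunit_conj_unit1:
  assumes "cell f" "dm f = E" "cd f = E" "E = unit1 B a" "a \<in> ob B"
  shows "\<l> E \<diamondop> (f \<boxtimes> I E) \<diamondop> (\<l> E)\<^sup>\<dagger> = f"
proof -
  note assms(1-3,5) [simp] assms(4)[symmetric, simp]
  have E [simp]: "E \<in> objs B" "src B E = a" "tgt B E = a"
    using unit1_objs[of a] by (simp_all del: unit1_objs)
  have lr: "\<l> E = \<r> E" using lunit_unit1[of a] by simp
  show ?thesis using runit_nat[of f E] vcomp_head[OF runit_nat[of f E], of "(\<l> E)\<^sup>\<dagger>"]
    by (simp add: lr)
qed

text \<open>
  Since \<open>u\<close> has a right inverse, tensoring with \<open>1\<close>, which is faithful, factors through tensoring with
  \<open>Y \<otimes> X\<close>, hence through \<open>X \<otimes> -\<close>.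
\<close>

lemma left_whisker_faithful:
  assumes Y: "Y \<in> objs B" "X \<in> objs B" "tgt B Y = src B X"
    and u: "cell u" "dm u = Y \<otimes> X" "cd u = E" and v: "cell v" "dm v = E" "cd v = Y \<otimes> X" "u \<diamondop> v = I E"
    and E_eq: "E = unit1 B (tgt B X)"
    and s: "cell s" "cell t" "dm s = dm t" "cd s = cd t" "src B (dm t) = tgt B X" "I X \<boxtimes> s = I X \<boxtimes> t"
  shows "s = t"
proof -
  note Y [simp] u [simp] v [simp] s(1-5)[simp] E_eq [symmetric, simp]
  have st [simp]: "src B (cd t) = tgt B X"
    using s by simp
  have E [simp]: "E \<in> objs B" "src B E = tgt B X" "tgt B E = tgt B X"
    using unit1_objs[of "tgt B X"] by (simp_all del: unit1_objs)
  have YX: "src B Y = tgt B X"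
    using cell_objs(3)[OF u(1)] by (simp del: cell_objs)
  note YX [simp]
  have key: "w \<diamondop> \<l> (dm t) = \<l> (cd t) \<diamondop> (u \<boxtimes> I (cd t)) \<diamondop> (\<alpha> Y X (cd t))\<^sup>\<dagger> \<diamondop> (I Y \<boxtimes> (I X \<boxtimes> w)) \<diamondop>
      \<alpha> Y X (dm t) \<diamondop> (v \<boxtimes> I (dm t))"
    if w [simp]: "cell w" "dm w = dm t" "cd w = cd t" for w
  proof -
    have 1: "(I Y \<boxtimes> (I X \<boxtimes> w)) \<diamondop> \<alpha> Y X (dm t) = \<alpha> Y X (cd t) \<diamondop> (I (Y \<otimes> X) \<boxtimes> w)"
      using assoc_nat[of "I Y" "I X" w] by simp
    have 2: "(u \<boxtimes> I (cd t)) \<diamondop> (I (Y \<otimes> X) \<boxtimes> w) \<diamondop> (v \<boxtimes> I (dm t)) = I E \<boxtimes> w"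
      by (simp add: interchange[symmetric])
    show ?thesis
      using lunit_nat[of w E] by (simp add: vcomp_head[OF 1] 2)
  qed
  show ?thesis
    by (rule unitary_right_cancel[of "\<l> (dm t)"]) (use key[of s] key[of t] s(6) in auto)
qed

section \<open>Transformations between representable 2-functors\<close>

definition component :: "('o, 'm, 'c) transf \<Rightarrow> ('m, 'c) cell \<Rightarrow> ('m, 'c) cell" where
  "component \<theta> t = (let c = src B (dm t) in
     Cell (tobj \<theta> c (dm t)) (tmap \<theta> c (dm t) (cd t) (val t)) (tobj \<theta> c (cd t)))"

definition naturator :: "('o, 'm, 'c) transf \<Rightarrow> 'm \<Rightarrow> 'm \<Rightarrow> ('m, 'c) cell" where
  "naturator \<theta> Y Z = Cell (tobj \<theta> (src B Y) (Y \<otimes> Z)) (tnat \<theta> Y Z) (Y \<otimes> tobj \<theta> (tgt B Y) Z)"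

context
  fixes a b \<theta>
  assumes \<theta>: "unitary_transformation B a b \<theta>" and a_ob: "a \<in> ob B"
begin

lemma component_functor: "c \<in> ob B \<Longrightarrow> linear_dagger_functor (homcat B c a) (homcat B c b) (tobj \<theta> c) (tmap \<theta> c)"
  using \<theta> unfolding unitary_transformation_def by simp

lemma tobj_objs:
  assumes "Z \<in> objs B" "tgt B Z = a" "src B Z = c"
  shows "tobj \<theta> c Z \<in> objs B" "src B (tobj \<theta> c Z) = c" "tgt B (tobj \<theta> c Z) = b"
  using linear_dagger_functorD(1)[OF component_functor[OF src_ob[OF assms(1)]], of Z] assms
  by (auto simp: mor1_def)

lemma component_boundary [simp]:
  "dm (component \<theta> t) = tobj \<theta> (src B (dm t)) (dm t)" "cd (component \<theta> t) = tobj \<theta> (src B (dm t)) (cd t)"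
  by (simp_all add: component_def Let_def)

lemma component_cell:
  assumes "cell t" "tgt B (dm t) = a"
  shows "cell (component \<theta> t)"
  using linear_dagger_functorD(3)[OF component_functor[of "src B (dm t)"], of "dm t" "cd t" "val t"]
    cell_mor1[OF assms(1)] tobj_objs[of "dm t"] tobj_objs[of "cd t"] assms
  unfolding cell_def[of "component \<theta> t"] by (simp add: component_def Let_def)

lemma component_vcomp:
  assumes "cell t" "cell s" "cd s = dm t" "tgt B (dm t) = a"
  shows "component \<theta> (t \<diamondop> s) = component \<theta> t \<diamondop> component \<theta> s"
proof -
  have ob: "src B (dm s) \<in> ob B" using assms by simp
  have m: "dm s \<in> mor1 B (src B (dm s)) a" "dm t \<in> mor1 B (src B (dm s)) a" "cd t \<in> mor1 B (src B (dm s)) a"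
    and v: "val s \<in> hom B (dm s) (dm t)" "val t \<in> hom B (dm t) (cd t)" and st: "src B (dm t) = src B (dm s)"
    using cell_mor1[OF assms(1)] cell_mor1[OF assms(2)] assms(3,4) by (auto simp: mor1_def)
  show ?thesis
    using linear_dagger_functorD(5)[OF component_functor[OF ob], of "dm s" "dm t" "cd t" "val s" "val t"] m v
    by (simp add: component_def Let_def vcomp_def assms(3) st)
qed

lemma component_I: "\<lbrakk>X \<in> objs B; tgt B X = a\<rbrakk> \<Longrightarrow> component \<theta> (I X) = I (tobj \<theta> (src B X) X)"
  using linear_dagger_functorD(2)[OF component_functor[of "src B X"], of X]
  by (simp add: component_def I_def Let_def mor1_def)

lemma component_dagger: "\<lbrakk>cell t; tgt B (dm t) = a\<rbrakk> \<Longrightarrow> component \<theta> (t\<^sup>\<dagger>) = (component \<theta> t)\<^sup>\<dagger>"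
  using linear_dagger_functorD(4)[OF component_functor[of "src B (dm t)"], of "dm t" "cd t" "val t"] cell_mor1[of t]
  by (simp add: component_def dagger_def Let_def)

lemma component_unitary:
  assumes "unitary_cell t" "tgt B (dm t) = a"
  shows "unitary_cell (component \<theta> t)"
proof -
  have t: "cell t" using assms by (simp add: unitary_is_cell)
  have "component \<theta> (t\<^sup>\<dagger>) \<diamondop> component \<theta> t = component \<theta> (I (dm t))"
       "component \<theta> t \<diamondop> component \<theta> (t\<^sup>\<dagger>) = component \<theta> (I (cd t))"
    using t assms by (simp_all add: component_vcomp[symmetric])
  thus ?thesis using t assms(2)
    by (simp add: unitary_cell_def component_cell component_dagger component_I del: unitary_cancel)
qed

lemma naturator_unitary:
  assumes "Y \<in> objs B" "Z \<in> objs B" "tgt B Y = src B Z" "tgt B Z = a"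
  shows "unitary_cell (naturator \<theta> Y Z)"
proof -
  have "unitary B (tobj \<theta> (src B Y) (Y \<otimes> Z)) (Y \<otimes> tobj \<theta> (src B Z) Z) (tnat \<theta> Y Z)"
    using \<theta> in_mor1[of Y] in_mor1[of Z] assms unfolding unitary_transformation_def by simp
  thus ?thesis
    using tobj_objs[of "Y \<otimes> Z" "src B Y"] tobj_objs[of Z "src B Z"] assms
    unfolding unitary_cell_iff cell_def unitary_def naturator_def by simp
qed

lemma naturator_natural:
  assumes f: "cell f" and Z: "Z \<in> objs B" "tgt B (dm f) = src B Z" "tgt B Z = a"
  shows "naturator \<theta> (cd f) Z \<diamondop> component \<theta> (f \<boxtimes> I Z) = (f \<boxtimes> I (tobj \<theta> (src B Z) Z)) \<diamondop> naturator \<theta> (dm f) Z"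
proof -
  have "tnat \<theta> (cd f) Z \<cdot> tmap \<theta> (src B (dm f)) (dm f \<otimes> Z) (cd f \<otimes> Z) (rwh B (dm f) (cd f) Z (val f)) =
        rwh B (dm f) (cd f) (tobj \<theta> (src B Z) Z) (val f) \<cdot> tnat \<theta> (dm f) Z"
    using \<theta> cell_mor1[OF f] in_mor1[OF Z(1)] Z f cell_objs(1)[OF f]
    unfolding unitary_transformation_def by simp
  thus ?thesis
    using Z f by (simp add: vcomp_def hcomp_def component_def naturator_def Let_def I_def rwh_def)
qed

text \<open>
  The unitary \<open>\<theta> Z \<Rightarrow> Z \<otimes> X\<close>, where \<open>X\<close> is the representing 1-morphism.
\<close>

definition compare :: "'m \<Rightarrow> ('m, 'c) cell" where
  "compare Z = naturator \<theta> Z (unit1 B a) \<diamondop> component \<theta> ((\<r> Z)\<^sup>\<dagger>)"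

lemma compare_unitary:
  assumes Z [simp]: "Z \<in> objs B" "tgt B Z = a"
  shows "unitary_cell (compare Z)" "dm (compare Z) = tobj \<theta> (src B Z) Z"
    "cd (compare Z) = Z \<otimes> representing B a \<theta>"
proof -
  have "unitary_cell (naturator \<theta> Z (unit1 B a))" by (rule naturator_unitary) (auto simp: a_ob)
  moreover have "unitary_cell (component \<theta> ((\<r> Z)\<^sup>\<dagger>))" by (rule component_unitary) (auto simp: a_ob)
  moreover have "cd (component \<theta> ((\<r> Z)\<^sup>\<dagger>)) = dm (naturator \<theta> Z (unit1 B a))"
    by (simp add: naturator_def)
  ultimately show "unitary_cell (compare Z)" by (simp add: compare_def)
  show "dm (compare Z) = tobj \<theta> (src B Z) Z" by (simp add: compare_def)
  show "cd (compare Z) = Z \<otimes> representing B a \<theta>" by (simp add: compare_def naturator_def representing_def)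
qed

text \<open>
  Together with \<open>compare_unitary\<close> this is the Yoneda lemma: \<open>\<theta>\<close> is unitarily equivalent to
  \<open>- \<otimes> X\<close>.
\<close>

lemma compare_natural:
  assumes f: "cell f" and fa: "tgt B (dm f) = a"
  shows "compare (cd f) \<diamondop> component \<theta> f = (f \<boxtimes> I (representing B a \<theta>)) \<diamondop> compare (dm f)"
proof -
  define E where "E = unit1 B a"
  note f [simp] fa [simp] a_ob [simp] E_def [symmetric, simp]
  have E [simp]: "E \<in> objs B" "src B E = a" "tgt B E = a"
    using unit1_objs[of a] by (simp_all del: unit1_objs)
  have rn: "(\<r> (cd f))\<^sup>\<dagger> \<diamondop> f = (f \<boxtimes> I E) \<diamondop> (\<r> (dm f))\<^sup>\<dagger>"
    using arg_cong[OF runit_nat[of "f\<^sup>\<dagger>" E], of dagger] by simp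
  have N [simp]: "cell (naturator \<theta> Z E)" "dm (naturator \<theta> Z E) = tobj \<theta> (src B Z) (Z \<otimes> E)"
    "cd (naturator \<theta> Z E) = Z \<otimes> representing B a \<theta>"
    if "Z \<in> objs B" "tgt B Z = a" for Z
    using naturator_unitary[of Z E] that by (simp_all add: unitary_is_cell naturator_def representing_def)
  note [simp] = component_cell
  have X [simp]: "representing B a \<theta> \<in> objs B" "src B (representing B a \<theta>) = a"
    using tobj_objs[of E a] by (simp_all add: representing_def)
  have rep: "tobj \<theta> a E = representing B a \<theta>" by (simp add: representing_def)
  have "compare (cd f) \<diamondop> component \<theta> f = naturator \<theta> (cd f) E \<diamondop> component \<theta> ((\<r> (cd f))\<^sup>\<dagger> \<diamondop> f)"
    by (simp add: compare_def component_vcomp)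
  also have "\<dots> = naturator \<theta> (cd f) E \<diamondop> component \<theta> (f \<boxtimes> I E) \<diamondop> component \<theta> ((\<r> (dm f))\<^sup>\<dagger>)"
    by (simp add: rn component_vcomp)
  also have "\<dots> = (f \<boxtimes> I (representing B a \<theta>)) \<diamondop> naturator \<theta> (dm f) E \<diamondop> component \<theta> ((\<r> (dm f))\<^sup>\<dagger>)"
    using vcomp_head[OF naturator_natural[of f E], of "component \<theta> ((\<r> (dm f))\<^sup>\<dagger>)"]
    by (simp add: rep)
  finally show ?thesis by (simp add: compare_def)
qed

text \<open>
  The comparison unitaries transport fullness and faithfulness from the component of \<open>\<theta>\<close> at \<open>c\<close>.
\<close>

lemma whisker_representing_fully_faithful:
  assumes eqv: "dagger_equivalence (homcat B c a) (homcat B c b) (tobj \<theta> c) (tmap \<theta> c)"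
    and Z [simp]: "Z \<in> objs B" "tgt B Z = a" "src B Z = c" and Z' [simp]: "Z' \<in> objs B" "tgt B Z' = a" "src B Z' = c"
  shows "\<lbrakk>cell s; cell t; dm s = Z; cd s = Z'; dm t = Z; cd t = Z';
      s \<boxtimes> I (representing B a \<theta>) = t \<boxtimes> I (representing B a \<theta>)\<rbrakk> \<Longrightarrow> s = t"
    and "\<lbrakk>cell h; dm h = Z \<otimes> representing B a \<theta>; cd h = Z' \<otimes> representing B a \<theta>\<rbrakk>
      \<Longrightarrow> \<exists>r. cell r \<and> dm r = Z \<and> cd r = Z' \<and> r \<boxtimes> I (representing B a \<theta>) = h"
proof -
  let ?X = "representing B a \<theta>"
  have c: "c \<in> ob B" using src_ob[OF Z(1)] by simp
  have obE: "tobj \<theta> c Z \<in> objs B" "tobj \<theta> c Z' \<in> objs B" "tgt B (tobj \<theta> c Z) = b" using tobj_objs by simp_all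
  have b: "b \<in> ob B" using tgt_ob[OF obE(1)] obE(3) by simp
  have X [simp]: "?X \<in> objs B" "src B ?X = a"
    using tobj_objs[of "unit1 B a" a] a_ob by (simp_all add: representing_def)
  have bij: "bij_betw (tmap \<theta> c Z Z') (hom B Z Z') (hom B (tobj \<theta> c Z) (tobj \<theta> c Z'))"
    using dagger_equivalence_fully_faithful[OF _ _ eqv, of Z Z'] homcat_cstar[OF c a_ob] homcat_cstar[OF c b]
    by (simp add: cstar_category_def mor1_def)
  note cu = compare_unitary[OF Z(1,2)] compare_unitary[OF Z'(1,2)]
  have cc [simp]: "cell (compare Z)" "cell (compare Z')" using cu by (simp_all add: unitary_is_cell)
  note cu [simp] component_cell [simp]
  show "s = t" if st: "cell s" "cell t" "dm s = Z" "cd s = Z'" "dm t = Z" "cd t = Z'" "s \<boxtimes> I ?X = t \<boxtimes> I ?X"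
  proof -
    have "compare Z' \<diamondop> component \<theta> s = compare Z' \<diamondop> component \<theta> t"
      using compare_natural[of s] compare_natural[of t] st by simp
    hence "component \<theta> s = component \<theta> t"
      by (rule unitary_left_cancel[rotated -1]) (use st in auto)
    hence "tmap \<theta> c Z Z' (val s) = tmap \<theta> c Z Z' (val t)"
      using st by (simp add: component_def Let_def)
    hence "val s = val t"
      using bij_betw_imp_inj_on[OF bij] cell_mor1(3)[of s] cell_mor1(3)[of t] st by (auto dest: inj_onD)
    thus ?thesis using st by (simp add: cell.expand)
  qed
  show "\<exists>r. cell r \<and> dm r = Z \<and> cd r = Z' \<and> r \<boxtimes> I ?X = h"
    if h [simp]: "cell h" "dm h = Z \<otimes> ?X" "cd h = Z' \<otimes> ?X"
  proof -
    define k where "k = (compare Z')\<^sup>\<dagger> \<diamondop> h \<diamondop> compare Z"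
    have k: "cell k" "dm k = tobj \<theta> c Z" "cd k = tobj \<theta> c Z'" by (auto simp: k_def)
    have "val k \<in> tmap \<theta> c Z Z' ` hom B Z Z'"
      using bij_betw_imp_surj_on[OF bij] cell_mor1(3)[OF k(1)] k by simp
    then obtain f where f: "f \<in> hom B Z Z'" "val k = tmap \<theta> c Z Z' f" by blast
    define r where "r = Cell Z f Z'"
    have r [simp]: "cell r" "dm r = Z" "cd r = Z'" using f Z Z' by (auto simp: r_def cell_def)
    have "component \<theta> r = k"
      by (rule cell.expand) (use k f in \<open>simp add: component_def r_def\<close>)
    hence "(r \<boxtimes> I ?X) \<diamondop> compare Z = compare Z' \<diamondop> k"
      using compare_natural[of r] by simp
    also have "\<dots> = h \<diamondop> compare Z"
      by (simp add: k_def)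
    finally have "r \<boxtimes> I ?X = h"
      by (rule unitary_right_cancel[rotated -1]) auto
    thus ?thesis using r by blast
  qed
qed

end

section \<open>Traces\<close>

text \<open>
  Evaluating the hypothesis at \<open>f = (z - 1)\<^sup>\<dagger>\<close> gives \<open>\<phi>(f\<^sup>\<dagger> f) = 0\<close>.
\<close>

lemma faithful_functional_unit:
  assumes \<phi>: "faithful_positive_functional B E \<phi>" and E: "E \<in> objs B"
    and z: "z \<in> hom B E E" and eq: "\<And>f. f \<in> hom B E E \<Longrightarrow> \<phi> (z \<cdot> f) = \<phi> f"
  shows "z = idn B E"
proof -
  have add: "\<forall>f\<in>hom B E E. \<forall>g\<in>hom B E E. \<phi> (f + g) = \<phi> f + \<phi> g"
    and faithful: "\<forall>f\<in>hom B E E. \<phi> (dag B f \<cdot> f) = 0 \<longrightarrow> f = 0"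
    using \<phi> unfolding faithful_positive_functional_def by simp_all
  interpret H: dagger_category "homcat B (src B E) (tgt B E)"
    by (rule homcat_dagger_category[OF E])
  interpret V: vector_space "scal B" using H.vs by simp
  have E': "E \<in> objs (homcat B (src B E) (tgt B E))" using E by (simp add: mor1_def)
  have sub: "V.subspace (hom B E E)" using H.hom_subspace[OF E' E'] by simp
  have i: "idn B E \<in> hom B E E" using H.idn_hom[OF E'] by simp
  have "z - idn B E \<in> hom B E E" using V.subspace_diff[OF sub z i] .
  define w where "w = dag B (z - idn B E)"
  have y: "z - idn B E \<in> hom B E E" by fact
  have w: "w \<in> hom B E E" using H.dag_hom[OF E' E'] y by (simp add: w_def)
  have dw: "dag B w = z - idn B E" using H.dag_dag[OF E' E'] y by (simp add: w_def)
  have yw: "(z - idn B E) \<cdot> w \<in> hom B E E" using H.cmp_hom[OF E' E' E'] y w by simp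
  have "z \<cdot> w = (z - idn B E) \<cdot> w + idn B E \<cdot> w"
    using H.cmp_add_left[OF E' E' E', of w "z - idn B E" "idn B E"] y w i by simp
  hence "z \<cdot> w = (z - idn B E) \<cdot> w + w"
    using H.idn_cmp[OF E' E'] w by simp
  moreover have "\<phi> ((z - idn B E) \<cdot> w + w) = \<phi> ((z - idn B E) \<cdot> w) + \<phi> w"
    using add yw w by simp
  ultimately have "\<phi> (dag B w \<cdot> w) = 0"
    using eq[OF w] by (simp add: dw)
  hence "w = 0" using faithful w by simp
  hence "z - idn B E = dag B 0" using dw by simp
  also have "dag B 0 = 0"
    using H.dag_scal[OF E' E', of w 0] w by simp
  finally show ?thesis by simp
qed

lemma trace_conj:
  assumes tr: "two_hilbert_space (homcat B c b) \<tau>"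
    and u: "unitary_cell u" "src B (dm u) = c" "tgt B (dm u) = b"
    and k: "cell k" "dm k = dm u" "cd k = dm u"
  shows "\<tau> (cd u) (val (u \<diamondop> k \<diamondop> u\<^sup>\<dagger>)) = \<tau> (dm u) (val k)"
proof -
  have uc [simp]: "cell u" using u by (simp add: unitary_is_cell)
  note u [simp] k [simp]
  define g where "g = k \<diamondop> u\<^sup>\<dagger>"
  have g [simp]: "cell g" "dm g = cd u" "cd g = dm u" by (auto simp: g_def)
  have cyc: "\<forall>X\<in>mor1 B c b. \<forall>Y\<in>mor1 B c b. \<forall>f\<in>hom B X Y. \<forall>g\<in>hom B Y X. \<tau> X (g \<cdot> f) = \<tau> Y (f \<cdot> g)"
    using tr unfolding two_hilbert_space_def homcat_simps by (elim conjE)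
  have "\<tau> (dm u) (val g \<cdot> val u) = \<tau> (cd u) (val u \<cdot> val g)"
    by (rule cyc[rule_format]) (use cell_mor1[OF uc] cell_mor1(3)[OF g(1)] in simp_all)
  hence "\<tau> (dm u) (val (g \<diamondop> u)) = \<tau> (cd u) (val (u \<diamondop> g))" by (simp add: vcomp_def)
  thus ?thesis by (simp add: g_def)
qed

section \<open>Unitary adjoint functors and the representing equivalence\<close>

lemma uaf_adjunction:
  assumes "unitary_adjoint_functor B D" "X \<in> objs B"
  shows "adjunction X (dual D X) (Cell (dual D X \<otimes> X) (ev D X) (unit1 B (tgt B X)))
     (Cell (unit1 B (src B X)) (coev D X) (X \<otimes> dual D X))"
proof (rule is_adjoint_adjunction)
  show "is_adjoint B (src B X) (tgt B X) X (dual D X) (ev D X) (coev D X)"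
    using assms in_mor1[of X] unfolding unitary_adjoint_functor_def by simp
qed

text \<open>
  This normalises the traces: the loop of \<open>1\<^sub>a\<close> is trivial, so \<open>weight_trace\<close> on the endomorphisms of
  \<open>1\<^sub>a\<close> is the weight \<open>\<Psi>\<^sub>a\<close> itself.
\<close>

lemma uaf_coev_unit1:
  assumes uaf: "unitary_adjoint_functor B D" and a: "a \<in> ob B" and E: "E = unit1 B a"
  shows "dag B (coev D E) \<cdot> coev D E = idn B E"
proof -
  have E1 [simp]: "E \<in> objs B" "src B E = a" "tgt B E = a" using a E by simp_all
  define e d where "e = Cell (dual D E \<otimes> E) (ev D E) E" and "d = Cell E (coev D E) (E \<otimes> dual D E)"
  have adj: "adjunction E (dual D E) e d"
    using uaf_adjunction[OF uaf E1(1)] by (simp add: e_def d_def E[symmetric])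
  have "unitary B (dual D E) E (ev D E \<cdot> dag B (runit B (dual D E)))"
    using uaf a unfolding unitary_adjoint_functor_def dual_unit_map_def E by blast
  moreover have "cell (e \<diamondop> (\<r> (dual D E))\<^sup>\<dagger>)"
    using adj by (simp add: adjunction_def E[symmetric])
  ultimately have "unitary_cell (e \<diamondop> (\<r> (dual D E))\<^sup>\<dagger>)"
    by (simp add: unitary_cell_iff e_def vcomp_def dagger_def \<r>_def)
  hence "d\<^sup>\<dagger> \<diamondop> d = I E"
    by (rule unit1_coev_isometric[OF adj E a])
  thus ?thesis by (simp add: d_def vcomp_def dagger_def I_def)
qed

lemma left_trace_dual_unit_action:
  assumes uaf: "unitary_adjoint_functor B D" and X: "X \<in> objs B" and E: "E = unit1 B (src B X)"
    and f: "cell f" "dm f = E" "cd f = E"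
  shows "left_trace B D X (val (\<l> X \<diamondop> (f \<boxtimes> I X) \<diamondop> (\<l> X)\<^sup>\<dagger>)) = dag B (coev D X) \<cdot> coev D X \<cdot> val f"
proof -
  have "(Cell E (coev D X) (X \<otimes> dual D X))\<^sup>\<dagger> \<diamondop> ((\<l> X \<diamondop> (f \<boxtimes> I X) \<diamondop> (\<l> X)\<^sup>\<dagger>) \<boxtimes> I (dual D X)) \<diamondop>
      Cell E (coev D X) (X \<otimes> dual D X)
    = ((Cell E (coev D X) (X \<otimes> dual D X))\<^sup>\<dagger> \<diamondop> Cell E (coev D X) (X \<otimes> dual D X)) \<diamondop> f"
    by (rule left_trace_unit_action[OF uaf_adjunction[OF uaf X, folded E] E f])
  also have "\<dots> = (Cell E (coev D X) (X \<otimes> dual D X))\<^sup>\<dagger> \<diamondop> Cell E (coev D X) (X \<otimes> dual D X) \<diamondop> f"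
    by (rule vcomp_assoc) (use uaf_adjunction[OF uaf X, folded E] f in \<open>auto simp: adjunction_def\<close>)
  finally show ?thesis
    by (simp add: left_trace_def rwh_def vcomp_def hcomp_def dagger_def I_def \<l>_def)
qed

lemma representing_isometric_equivalence:
  assumes uaf: "unitary_adjoint_functor B D" and sph: "spherical_weight B D \<Psi>"
    and a: "a \<in> ob B" and b: "b \<in> ob B"
    and eqv: "natural_unitary_equivalence B a b \<theta>" and iso: "pointwise_isometric B D \<Psi> a b \<theta>"
  shows "isometric_equivalence1 B D a b (representing B a \<theta>)"
proof -
  define X where "X = representing B a \<theta>"
  define E E' where "E = unit1 B a" and "E' = unit1 B b"
  define d e where "d = Cell E (coev D X) (X \<otimes> dual D X)" and "e = Cell (dual D X \<otimes> X) (ev D X) E'"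
  have \<theta>: "unitary_transformation B a b \<theta>"
    using eqv unfolding natural_unitary_equivalence_def by blast
  have E: "E \<in> objs B" "src B E = a" "tgt B E = a" "E' \<in> objs B" "src B E' = b" "tgt B E' = b"
    using a b by (simp_all add: E_def E'_def)
  have X: "X \<in> objs B" "src B X = a" "tgt B X = b"
    using tobj_objs[OF \<theta> a E(1,3,2)] by (simp_all add: X_def representing_def E_def)
  have iso_a: "isometric_equivalence_2Hilb (homcat B a a) (weight_trace B D \<Psi>) (homcat B a b) (weight_trace B D \<Psi>)
        (tobj \<theta> a) (tmap \<theta> a)"
    using iso a unfolding pointwise_isometric_def by simp
  have de: "dagger_equivalence (homcat B a a) (homcat B a b) (tobj \<theta> a) (tmap \<theta> a)"
    and tr: "two_hilbert_space (homcat B a b) (weight_trace B D \<Psi>)"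
    and Tr: "\<And>f. f \<in> hom B E E \<Longrightarrow> weight_trace B D \<Psi> (tobj \<theta> a E) (tmap \<theta> a E E f) = weight_trace B D \<Psi> E f"
    using iso_a E unfolding isometric_equivalence_2Hilb_def by (simp_all add: mor1_def)
  have adj: "adjunction X (dual D X) e d"
    using uaf_adjunction[OF uaf X(1)] by (simp add: d_def e_def E_def E'_def X)
  note [simp] = E X
  have d [simp]: "cell d" "dm d = E" "cd d = X \<otimes> dual D X" and dX [simp]: "dual D X \<in> objs B" "src B (dual D X) = b" "tgt B (dual D X) = a"
    using adj by (simp_all add: adjunction_def E_def)
  have EX: "E = unit1 B (src B X)" "E' = unit1 B (tgt B X)" by (simp_all add: E_def E'_def)

  \<comment> \<open>the two sides are the traces of \<open>f\<close> acting on \<open>X\<close> and of \<open>f\<close> on \<open>1\<^sub>a\<close>\<close>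
  have trace: "\<Psi> a (dag B (coev D X) \<cdot> coev D X \<cdot> f) = \<Psi> a f" if f: "f \<in> hom B E E" for f
  proof -
    define t where "t = Cell E f E"
    have t [simp]: "cell t" "dm t = E" "cd t = E" and tv: "val t = f"
      using f by (auto simp: t_def cell_def simp del: cell_objs)
    have lE: "\<l> E \<diamondop> (t \<boxtimes> I E) \<diamondop> (\<l> E)\<^sup>\<dagger> = t"
      by (rule lunit_conj_unit1[of _ _ a]) (simp_all add: a E_def[symmetric])
    have "left_trace B D E f = dag B (coev D E) \<cdot> coev D E \<cdot> f"
      using left_trace_dual_unit_action[OF uaf E(1), of E t] by (simp add: E_def[symmetric] lE tv)
    also have "\<dots> = f"
    proof -
      define dE where "dE = Cell E (coev D E) (E \<otimes> dual D E)"
      have dE: "cell dE" "dm dE = E" "cd dE = E \<otimes> dual D E"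
        using uaf_adjunction[OF uaf E(1)] by (simp_all add: adjunction_def dE_def E_def[symmetric])
      have "dE\<^sup>\<dagger> \<diamondop> dE = I E"
        using uaf_coev_unit1[OF uaf a E_def] by (simp add: dE_def vcomp_def dagger_def I_def)
      hence "dE\<^sup>\<dagger> \<diamondop> dE \<diamondop> t = t"
        using vcomp_head[of "dE\<^sup>\<dagger>" dE "I E" t] dE by simp
      hence "val (dE\<^sup>\<dagger> \<diamondop> dE \<diamondop> t) = val t" by simp
      thus ?thesis by (simp add: dE_def vcomp_def dagger_def t_def)
    qed
    finally have left: "weight_trace B D \<Psi> E f = \<Psi> a f" by (simp add: weight_trace_def)
    define \<rho> where "\<rho> = compare a \<theta> E"
    have \<rho> [simp]: "unitary_cell \<rho>" "dm \<rho> = tobj \<theta> a E" "cd \<rho> = E \<otimes> X"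
      using compare_unitary[OF \<theta> a, of E] by (simp_all add: \<rho>_def X_def)
    have \<rho>c [simp]: "cell \<rho>" by (simp add: unitary_is_cell)
    have c: "cell (component \<theta> t)" by (rule component_cell[OF \<theta> a]) auto
    have ct: "dm (component \<theta> t) = tobj \<theta> a E" "cd (component \<theta> t) = tobj \<theta> a E" by (simp_all add: component_def Let_def)
    have TE: "src B (tobj \<theta> a E) = a" "tgt B (tobj \<theta> a E) = b"
      using tobj_objs[OF \<theta> a] by simp_all
    have "\<rho> \<diamondop> component \<theta> t = (t \<boxtimes> I X) \<diamondop> \<rho>"
      using compare_natural[OF \<theta> a, of t] by (simp add: \<rho>_def X_def)
    hence "\<rho> \<diamondop> component \<theta> t \<diamondop> \<rho>\<^sup>\<dagger> = t \<boxtimes> I X"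
      using vcomp_head[of \<rho> "component \<theta> t" "(t \<boxtimes> I X) \<diamondop> \<rho>" "\<rho>\<^sup>\<dagger>"] c ct by simp
    hence 1: "weight_trace B D \<Psi> (E \<otimes> X) (val (t \<boxtimes> I X)) = weight_trace B D \<Psi> (tobj \<theta> a E) (val (component \<theta> t))"
      using trace_conj[OF tr, of \<rho> "component \<theta> t"] c ct TE by simp
    have "weight_trace B D \<Psi> X (val (\<l> X \<diamondop> (t \<boxtimes> I X) \<diamondop> (\<l> X)\<^sup>\<dagger>)) = weight_trace B D \<Psi> (E \<otimes> X) (val (t \<boxtimes> I X))"
      using trace_conj[OF tr, of "\<l> X" "t \<boxtimes> I X"] by (simp add: E_def[symmetric])
    also have "\<dots> = weight_trace B D \<Psi> E f"
      using Tr[OF f] by (simp add: 1) (simp add: component_def Let_def tv)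
    finally show ?thesis
      using left_trace_dual_unit_action[OF uaf X(1) EX(1) t] left by (simp add: weight_trace_def tv)
  qed
  have iso_d: "d\<^sup>\<dagger> \<diamondop> d = I E"
  proof -
    have z: "dag B (coev D X) \<cdot> coev D X \<in> hom B E E"
    proof -
      have "cell (d\<^sup>\<dagger> \<diamondop> d)" by simp
      from cell_mor1(3)[OF this] show ?thesis by (simp add: d_def vcomp_def dagger_def)
    qed
    have fpf: "faithful_positive_functional B E (\<Psi> a)"
      using sph a unfolding spherical_weight_def E_def by blast
    have "dag B (coev D X) \<cdot> coev D X = idn B E"
    proof (rule faithful_functional_unit[OF fpf E(1) z])
      fix f assume f: "f \<in> hom B E E"
      hence "cell (Cell E f E)" by (auto simp: cell_def simp del: cell_objs)
      hence "(d\<^sup>\<dagger> \<diamondop> d) \<diamondop> Cell E f E = d\<^sup>\<dagger> \<diamondop> d \<diamondop> Cell E f E" by simp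
      hence "(dag B (coev D X) \<cdot> coev D X) \<cdot> f = dag B (coev D X) \<cdot> coev D X \<cdot> f"
        by (simp add: d_def vcomp_def dagger_def)
      thus "\<Psi> a ((dag B (coev D X) \<cdot> coev D X) \<cdot> f) = \<Psi> a f" using trace[OF f] by simp
    qed
    thus ?thesis by (simp add: d_def vcomp_def dagger_def I_def)
  qed
  have d_unitary: "unitary_cell d"
  proof (rule coev_unitary[OF adj iso_d EX(1)])
    show "\<exists>r. cell r \<and> dm r = X \<otimes> dual D X \<and> cd r = E \<and> r \<boxtimes> I X = t"
      if "cell t" "dm t = X \<otimes> dual D X \<otimes> X" "cd t = E \<otimes> X" for t
      using whisker_representing_fully_faithful(2)[OF \<theta> a de, of "X \<otimes> dual D X" E t, folded X_def] that by simp
    show "s = I E" if "cell s" "dm s = E" "cd s = E" "s \<boxtimes> I X = I E \<boxtimes> I X" for s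
      using whisker_representing_fully_faithful(1)[OF \<theta> a de, of E E s "I E", folded X_def] that by simp
  qed

  \<comment> \<open>the inverse transformation yields \<open>Y\<close> and \<open>Y \<otimes> X \<Rightarrow> 1\<^sub>b\<close> with a right inverse\<close>
  obtain \<psi> m' where \<psi>: "unitary_transformation B b a \<psi>"
    and m': "invertible_modification B b (transf_comp B \<theta> \<psi>) (transf_id B) m'"
    using eqv unfolding natural_unitary_equivalence_def by blast
  define Y where "Y = tobj \<psi> b E'"
  have Y [simp]: "Y \<in> objs B" "src B Y = b" "tgt B Y = a"
    using tobj_objs[OF \<psi> b E(4,6,5)] by (simp_all add: Y_def)
  have "E' \<in> mor1 B b b" by (simp add: mor1_def)
  hence "invertible B (tobj \<theta> b Y) E' (m' b E')"
    using m' b unfolding invertible_modification_def transf_comp_def transf_id_def Y_def by simp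
  then obtain n where n: "m' b E' \<in> hom B (tobj \<theta> b Y) E'" "n \<in> hom B E' (tobj \<theta> b Y)" "m' b E' \<cdot> n = idn B E'"
    unfolding invertible_def by blast
  define M N where "M = Cell (tobj \<theta> b Y) (m' b E') E'" and "N = Cell E' n (tobj \<theta> b Y)"
  have TY: "tobj \<theta> b Y \<in> objs B" "src B (tobj \<theta> b Y) = b" "tgt B (tobj \<theta> b Y) = b"
    using tobj_objs[OF \<theta> a] by simp_all
  have MN [simp]: "cell M" "dm M = tobj \<theta> b Y" "cd M = E'" "cell N" "dm N = E'" "cd N = tobj \<theta> b Y"
    using n TY by (auto simp: M_def N_def cell_def simp del: cell_objs)
  have MN1: "M \<diamondop> N = I E'" by (simp add: M_def N_def vcomp_def I_def n)
  define \<rho> where "\<rho> = compare a \<theta> Y"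
  have \<rho> [simp]: "unitary_cell \<rho>" "dm \<rho> = tobj \<theta> b Y" "cd \<rho> = Y \<otimes> X"
    using compare_unitary[OF \<theta> a, of Y] by (simp_all add: \<rho>_def X_def)
  have \<rho>c [simp]: "cell \<rho>" by (simp add: unitary_is_cell)
  have faithful: "s = I (dm s)"
    if "cell s" "cd s = dm s" "tgt B X = src B (dm s)" "I X \<boxtimes> s = I X \<boxtimes> I (dm s)" for s
  proof (rule left_whisker_faithful[of Y X "M \<diamondop> \<rho>\<^sup>\<dagger>" E' "\<rho> \<diamondop> N"])
    show "(M \<diamondop> \<rho>\<^sup>\<dagger>) \<diamondop> \<rho> \<diamondop> N = I E'" by (simp add: MN1)
  qed (use that EX(2) in simp_all)
  have e_unitary: "unitary_cell e"
    by (rule ev_unitary[OF adj d_unitary faithful])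
  have "X \<in> mor1 B a b" by (simp add: mor1_def)
  thus ?thesis
    using d_unitary e_unitary
    by (simp add: isometric_equivalence1_def unitary_cell_iff d_def e_def E_def E'_def X_def)
qed

end

theorem corollary3p33:
  fixes \<XX> :: "('o, 'm, 'c::ab_group_add) bicat"
    and D :: "('m, 'c) adjoint_choice"
    and \<Psi> :: "'o \<Rightarrow> 'c \<Rightarrow> complex"
    and a b :: 'o
    and \<theta> :: "('o, 'm, 'c) transf"
  assumes "three_hilbert_space \<XX> D \<Psi>"
    and "a \<in> ob \<XX>" and "b \<in> ob \<XX>"
    and "natural_unitary_equivalence \<XX> a b \<theta>"
    and "pointwise_isometric \<XX> D \<Psi> a b \<theta>"
  shows "isometric_equivalence1 \<XX> D a b (representing \<XX> a \<theta>)"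
proof -
  have "pre_3_hilbert_space \<XX> D \<Psi>"
    using assms(1) by (simp add: three_hilbert_space_def)
  hence "cstar_2category \<XX>" "unitary_adjoint_functor \<XX> D" "spherical_weight \<XX> D \<Psi>"
    by (simp_all add: pre_3_hilbert_space_def finite_unitary_2category_def unitary_2category_def)
  thus ?thesis
    using assms(2-5) by (rule cstar_2category.representing_isometric_equivalence)
qed

end
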